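(* Let $\rho:[1,\infty)\to(0,1]$ be a decreasing bijection. Then there exist a distribution over one-dimensional stochastic optimization problem instances $(f,P_V)$ (a fixed sample objective $f:\mathbb R\times\mathcal S\to\mathbb R$ and a random distribution $P_V$ on $\mathcal S$ indexed by a random variable $V$), each realization $(f,P_v)$ of which satisfies $\mathbf{dist}(\mathbf 0,\arg\min F_{f,P_v})\le1$ and has $f(\cdot;s)$ convex and $1$-Lipschitz for all $s\in\mathcal S$, and a sequence of positive integers $n_1,n_2,\dots$ with $\lim_{k\to\infty}n_k=\infty$, such that for any stochastic optimization method that samples $n_i$ functions from $(f,P_V)$ and outputs $x^{\mathrm{out}}_{n_i}$, $$\mathbb P\left(F_{f,P_V}(x^{\mathrm{out}}_{n_i})-F^\star_{f,P_V}\ge\frac{\rho(n_i)}{\sqrt{n_i}}\right)\ge\frac16\qquad\text{for all }i\in\mathbb N .$$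
   Context: A stochastic optimization problem instance $(f,P)$ consists of a distribution $P$ on a sample space $\mathcal S$ and a sample objective $f$; $F_{f,P}(x):=\mathbb E_{S\sim P}f(x;S)$ and $F^\star_{f,P}:=\min_xF_{f,P}(x)$. $\mathbf{dist}(x,A)=\inf_{y\in A}\|x-y\|$ ($=\infty$ if $A=\emptyset$). A stochastic optimization method has unrestricted access to the sample objective $f$ but observes $P$ only through samples: its output after $n$ samples is $x^{\mathrm{out}}_n=\mathrm A_n(f,U,S^{(1)},\dots,S^{(n)})$, where $\mathrm A_n$ is a measurable mapping into the domain, $S^{(1)},\dots,S^{(n)}$ are (conditionally on $V$) i.i.d. from $P_V$, and $U\sim\mathsf{Unif}([0,1])$ is independent of the samples (and of $V$). The probability is over $V$, the samples and $U$. *)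

theory Defs
  imports "HOL-Probability.Probability"
begin

text \<open>
  A problem instance is a pair of a sample objective \<open>f :: 'x \<Rightarrow> 's \<Rightarrow> real\<close> and a
  probability measure \<open>P\<close> on the sample space.
\<close>

definition objective :: "('x \<Rightarrow> 's \<Rightarrow> real) \<Rightarrow> 's measure \<Rightarrow> 'x \<Rightarrow> real" where
  "objective f P x = (\<integral>s. f x s \<partial>P)"

text \<open>The infimum is the minimum whenever \<open>argmin (objective f P)\<close> is nonempty.\<close>

definition opt_value :: "('x \<Rightarrow> 's \<Rightarrow> real) \<Rightarrow> 's measure \<Rightarrow> real" where
  "opt_value f P = (INF x. objective f P x)"

definition argmin :: "('x \<Rightarrow> real) \<Rightarrow> 'x set" where
  "argmin F = {x. is_arg_min F (\<lambda>_. True) x}"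

text \<open>
  Extended-real valued so that the distance to the empty set is \<open>\<infinity>\<close>; the library's
  \<open>infdist\<close> and \<open>setdist\<close> return \<open>0\<close> there.
\<close>

definition edist_set :: "'x::metric_space \<Rightarrow> 'x set \<Rightarrow> ereal" where
  "edist_set x A = (INF y\<in>A. ereal (dist x y))"

text \<open>
  \<open>A n f u s\<close> is the output after the \<open>n\<close> samples \<open>s 1, \<dots>, s n\<close>. The dependence on \<open>f\<close> is
  unrestricted (there is no measurability requirement in \<open>f\<close>, which is a fixed parameter); the
  distribution is seen only through \<open>s\<close>, and \<open>u\<close> is the internal randomness.
\<close>

definition stochastic_method ::
  "'s measure \<Rightarrow> ('x::topological_space \<Rightarrow> 's \<Rightarrow> real) \<Rightarrow>
   (nat \<Rightarrow> ('x \<Rightarrow> 's \<Rightarrow> real) \<Rightarrow> real \<Rightarrow> (nat \<Rightarrow> 's) \<Rightarrow> 'x) \<Rightarrow> bool" where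
  "stochastic_method S f A \<longleftrightarrow>
     (\<forall>n. (\<lambda>(u, s). A n f u s) \<in> (borel :: real measure) \<Otimes>\<^sub>M PiM {1..n} (\<lambda>_. S) \<rightarrow>\<^sub>M borel)"

text \<open>
  Joint law of \<open>(V, U, (S 1, \<dots>, S n))\<close>: \<open>V\<close> has law \<open>Q\<close>, and given \<open>V = v\<close> the variables
  \<open>U, S 1, \<dots>, S n\<close> are independent, \<open>U\<close> uniform on \<open>[0,1]\<close> and each \<open>S j\<close> with law \<open>P v\<close>.
\<close>

definition sampling_law ::
  "'v measure \<Rightarrow> 's measure \<Rightarrow> ('v \<Rightarrow> 's measure) \<Rightarrow> nat \<Rightarrow> ('v \<times> real \<times> (nat \<Rightarrow> 's)) measure" where
  "sampling_law Q S P n =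
     Q \<bind> (\<lambda>v. distr (uniform_measure lborel {0..1} \<Otimes>\<^sub>M PiM {1..n} (\<lambda>_. P v))
                    (Q \<Otimes>\<^sub>M (borel \<Otimes>\<^sub>M PiM {1..n} (\<lambda>_. S))) (Pair v))"

end

theory Submission imports Defs begin

text \<open>
  The sign sequence \<open>\<sigma>\<close> of \<open>V\<close> selects a path in a binary tree of nested intervals. A sample first
  draws a level \<open>k\<close> (with law \<open>W\<close>) and then a coin of bias \<open>\<beta> k * \<sigma> k / 2\<close>; the expected loss of
  level \<open>k\<close> is minimized exactly on the child interval selected by \<open>\<sigma> k\<close>, so the limit point of the
  path minimizes all levels at once and the excess loss is at least that of any single level.
  A point on the wrong side of the level-\<open>i\<close> centre loses \<open>W i * \<beta> i * radius i / 4\<close>.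
  Flipping \<open>\<sigma> i\<close> changes the law of the samples only through the \<open>\<beta> i\<close>-bias at level \<open>i\<close>, which
  \<open>n i\<close> samples cannot detect if \<open>\<beta> i\<close> is of order \<open>1 / sqrt (n i)\<close> (second moment of the likelihood
  ratio), and through the positions at levels above \<open>i\<close>, which are rarely seen at all if
  \<open>n i * W {i<..}\<close> is small. Since \<open>\<rho>\<close> tends to \<open>0\<close>, \<open>n i\<close> can be chosen so large that
  \<open>\<rho> (n i)\<close> is below the constant \<open>W i * radius i / 20\<close>, and afterwards the mass of the levels above
  \<open>i\<close> is chosen small in terms of \<open>n i\<close>.
\<close>

subsection \<open>Testing two nearby product measures\<close>

text \<open>The indicator of a box factors over the coordinates, so on boxes the integral of the
  product density splits into one-dimensional integrals; boxes determine a product measure.\<close>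

lemma (in prob_space) PiM_density:
  assumes fin: "finite I" and h[measurable]: "h \<in> borel_measurable M"
    and P: "prob_space (density M h)"
  shows "PiM I (\<lambda>_. density M h) = density (PiM I (\<lambda>_. M)) (\<lambda>x. \<Prod>k\<in>I. h (x k))"
proof -
  interpret D: prob_space "density M h" by fact
  interpret D: product_prob_space "\<lambda>_. density M h" I by unfold_locales
  interpret B: product_prob_space "\<lambda>_. M" I by unfold_locales
  show ?thesis
  proof (rule D.PiM_eqI[symmetric, OF fin])
    show "sets (density (PiM I (\<lambda>_. M)) (\<lambda>x. \<Prod>k\<in>I. h (x k))) = sets (PiM I (\<lambda>_. density M h))"
      using sets_PiM_cong[of I I "\<lambda>_. M" "\<lambda>_. density M h"] by simp
    fix A assume "\<And>i. i \<in> I \<Longrightarrow> A i \<in> sets (density M h)"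
    then have A[measurable]: "\<And>i. i \<in> I \<Longrightarrow> A i \<in> sets M" by simp
    have "emeasure (density (PiM I (\<lambda>_. M)) (\<lambda>x. \<Prod>k\<in>I. h (x k))) (Pi\<^sub>E I A) =
        (\<integral>\<^sup>+x. (\<Prod>k\<in>I. h (x k)) * indicator (Pi\<^sub>E I A) x \<partial>PiM I (\<lambda>_. M))"
      using fin by (intro emeasure_density) auto
    also have "\<dots> = (\<integral>\<^sup>+x. (\<Prod>k\<in>I. h (x k) * indicator (A k) (x k)) \<partial>PiM I (\<lambda>_. M))"
    proof (rule nn_integral_cong)
      fix x assume "x \<in> space (PiM I (\<lambda>_. M))"
      then have "(indicator (Pi\<^sub>E I A) x :: ennreal) = (\<Prod>k\<in>I. indicator (A k) (x k))"
        using fin by (auto simp: indicator_def space_PiM PiE_iff)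
      then show "(\<Prod>k\<in>I. h (x k)) * indicator (Pi\<^sub>E I A) x = (\<Prod>k\<in>I. h (x k) * indicator (A k) (x k))"
        by (simp add: prod.distrib)
    qed
    also have "\<dots> = (\<Prod>k\<in>I. \<integral>\<^sup>+x. h x * indicator (A k) x \<partial>M)"
      using fin by (intro B.product_nn_integral_prod) auto
    also have "\<dots> = (\<Prod>k\<in>I. emeasure (density M h) (A k))"
      by (intro prod.cong refl) (simp add: emeasure_density)
    finally show "emeasure (density (PiM I (\<lambda>_. M)) (\<lambda>x. \<Prod>k\<in>I. h (x k))) (Pi\<^sub>E I A) =
      (\<Prod>i\<in>I. emeasure (density M h) (A i))" .
  qed
qed

lemma (in prob_space) prob_space_density_centred:
  fixes g :: "'a \<Rightarrow> real"
  assumes [measurable]: "g \<in> borel_measurable M" and g: "\<And>x. \<bar>g x\<bar> \<le> 1" and g0: "expectation g = 0"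
  shows "prob_space (density M (\<lambda>x. ennreal (1 + g x)))"
proof
  have int: "integrable M g"
    by (rule integrable_const_bound[where B=1]) (use g in auto)
  have "emeasure (density M (\<lambda>x. ennreal (1 + g x))) (space M) = (\<integral>\<^sup>+x. ennreal (1 + g x) \<partial>M)"
    by (subst emeasure_density) (auto intro!: nn_integral_cong)
  also have "\<dots> = ennreal (\<integral>x. 1 + g x \<partial>M)"
  proof (rule nn_integral_eq_integral)
    show "AE x in M. 0 \<le> 1 + g x" using g by (intro AE_I2) (smt (verit))
  qed (use int in auto)
  also have "\<dots> = 1"
    using int g0 by (simp add: prob_space)
  finally show "emeasure (density M (\<lambda>x. ennreal (1 + g x))) (space (density M (\<lambda>x. ennreal (1 + g x)))) = 1"
    by simp
qed

text \<open>The likelihood ratio \<open>L\<close> between the product measures has mean 1, and since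
  \<open>g\<close> is centred its second moment is at most
  \<open>(1 + \<beta>\<^sup>2) ^ card I\<close>. An event loses at most the mean of
  \<open>\<bar>L - 1\<bar>\<close>, which is bounded by
  \<open>2 * (17/16 - 1) + 1/8 = 1/4\<close>.\<close>

lemma (in prob_space) prob_PiM_density_ge:
  fixes g :: "'a \<Rightarrow> real"
  assumes fin: "finite I"
    and [measurable]: "g \<in> borel_measurable M" and g: "\<And>x. \<bar>g x\<bar> \<le> \<beta>" and "\<beta> \<le> 1"
    and g0: "expectation g = 0"
    and small: "(1 + \<beta>\<^sup>2) ^ card I \<le> 17 / 16"
    and Z[measurable]: "Z \<in> sets (PiM I (\<lambda>_. M))"
  shows "measure (PiM I (\<lambda>_. density M (\<lambda>x. ennreal (1 + g x)))) Z \<ge> measure (PiM I (\<lambda>_. M)) Z - 1 / 4"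
proof -
  interpret B: product_prob_space "\<lambda>_. M" I by unfold_locales
  let ?R = "PiM I (\<lambda>_. M)"
  define L where "L x = (\<Prod>k\<in>I. 1 + g (x k))" for x
  have g1: "\<bar>g x\<bar> \<le> 1" for x using g[of x] \<open>\<beta> \<le> 1\<close> by linarith
  have g1': "0 \<le> 1 + g x" for x using g1[of x] by linarith
  have P: "prob_space (density M (\<lambda>x. ennreal (1 + g x)))"
    by (rule prob_space_density_centred) (use g1 g0 in auto)
  have [measurable]: "L \<in> borel_measurable ?R"
    unfolding L_def by measurable
  have L0: "0 \<le> L x" for x unfolding L_def by (intro prod_nonneg g1' ballI)
  have int_g: "integrable M g"
    by (rule integrable_const_bound[where B=1]) (use g1 in auto)
  have int_g2: "integrable M (\<lambda>x. (g x)\<^sup>2)"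
    by (rule integrable_const_bound[where B=1]) (use g1 in \<open>auto simp: abs_square_le_1\<close>)
  have g2: "expectation (\<lambda>x. (g x)\<^sup>2) \<le> \<beta>\<^sup>2"
  proof -
    have "expectation (\<lambda>x. (g x)\<^sup>2) \<le> expectation (\<lambda>x. \<beta>\<^sup>2)"
      using g by (intro integral_mono int_g2) (auto simp: abs_le_square_iff[symmetric] intro: order_trans[OF g])
    then show ?thesis by (simp add: prob_space)
  qed
  have int_L: "integrable ?R L"
    unfolding L_def using int_g by (intro B.product_integrable_prod fin) auto
  have EL: "integral\<^sup>L ?R L = 1"
    unfolding L_def using int_g g0
    by (subst B.product_integral_prod[OF fin]) (auto simp: prob_space)
  have sq: "(1 + g x)\<^sup>2 = 1 + 2 * g x + (g x)\<^sup>2" for x by (simp add: power2_eq_square algebra_simps)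
  have L2: "(L x)\<^sup>2 = (\<Prod>k\<in>I. (1 + g (x k))\<^sup>2)" for x
    unfolding L_def by (simp add: prod_power_distrib)
  have int_L2: "integrable ?R (\<lambda>x. (L x)\<^sup>2)"
    unfolding L2 sq using int_g int_g2 by (intro B.product_integrable_prod fin) auto
  have EL2: "integral\<^sup>L ?R (\<lambda>x. (L x)\<^sup>2) \<le> 17 / 16"
  proof -
    have "integral\<^sup>L ?R (\<lambda>x. (L x)\<^sup>2) = (1 + expectation (\<lambda>x. (g x)\<^sup>2)) ^ card I"
      unfolding L2 sq using int_g int_g2 g0
      by (subst B.product_integral_prod[OF fin]) (auto simp: prob_space)
    also have "\<dots> \<le> (1 + \<beta>\<^sup>2) ^ card I"
      using g2 by (intro power_mono) auto
    finally show ?thesis using small by linarith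
  qed
  have "measure (PiM I (\<lambda>_. density M (\<lambda>x. ennreal (1 + g x)))) Z = measure (density ?R L) Z"
    using P fin g1' by (subst PiM_density) (auto simp: L_def prod_ennreal)
  also have "\<dots> = integral\<^sup>L ?R (\<lambda>x. L x * indicator Z x)"
  proof -
    have "emeasure (density ?R L) Z = (\<integral>\<^sup>+x. ennreal (L x * indicator Z x) \<partial>?R)"
      using L0 by (subst emeasure_density) (auto intro!: nn_integral_cong simp: indicator_def)
    also have "\<dots> = ennreal (integral\<^sup>L ?R (\<lambda>x. L x * indicator Z x))"
      using L0 int_L by (intro nn_integral_eq_integral) (auto intro!: integrable_real_mult_indicator)
    finally show ?thesis
      using L0 by (simp add: measure_def)
  qed
  finally have 1: "measure (PiM I (\<lambda>_. density M (\<lambda>x. ennreal (1 + g x)))) Z = integral\<^sup>L ?R (\<lambda>x. L x * indicator Z x)" .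
  have 2: "integral\<^sup>L ?R (\<lambda>x. L x * indicator Z x) \<ge> integral\<^sup>L ?R (\<lambda>x. indicator Z x - 2 * ((L x)\<^sup>2 - 2 * L x + 1) - 1 / 8)"
  proof (rule integral_mono)
    show "integrable ?R (\<lambda>x. indicator Z x - 2 * ((L x)\<^sup>2 - 2 * L x + 1) - 1 / 8)"
      using int_L int_L2 by (auto intro!: integrable_real_indicator simp: less_top[symmetric])
    show "integrable ?R (\<lambda>x. L x * indicator Z x)"
      using int_L by (auto intro!: integrable_real_mult_indicator)
    fix x
    \<comment> \<open>\<open>\<bar>L - 1\<bar> \<le> 2 (L - 1)\<^sup>2 + 1 / 8\<close>, so that only the second moment of \<open>L\<close> is needed\<close>
    have "0 \<le> 2 * (L x - 3 / 4)\<^sup>2" "0 \<le> 2 * (L x - 1)\<^sup>2" by auto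
    then show "indicator Z x - 2 * ((L x)\<^sup>2 - 2 * L x + 1) - 1 / 8 \<le> L x * indicator Z x"
      by (cases "x \<in> Z") (auto simp: power2_eq_square algebra_simps)
  qed
  have 3: "integral\<^sup>L ?R (\<lambda>x. indicator Z x - 2 * ((L x)\<^sup>2 - 2 * L x + 1) - 1 / 8) =
      measure ?R Z - 2 * (integral\<^sup>L ?R (\<lambda>x. (L x)\<^sup>2) - 1) - 1 / 8"
    using int_L int_L2 EL by (simp add: B.P.prob_space B.P.emeasure_eq_measure)
  show ?thesis using 1 2 3 EL2 by (simp add: algebra_simps)
qed

text \<open>Both hypotheses are compared with the untilted \<open>M\<close> halfway between them,
  each at a cost of 1/4. Under \<open>M\<close> the box of \<open>G\<close> has probability at least
  5/6 and is covered by the two error events, which leaves 5/6 - 1/2 = 1/3. Covering only this box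
  lets the events disagree on rare draws outside \<open>G\<close>.\<close>

lemma (in prob_space) two_point_testing:
  fixes g :: "'a \<Rightarrow> real"
  assumes fin: "finite I"
    and [measurable]: "g \<in> borel_measurable M" and g: "\<And>x. \<bar>g x\<bar> \<le> \<beta>" and "\<beta> \<le> 1"
    and g0: "expectation g = 0"
    and small: "(1 + \<beta>\<^sup>2) ^ card I \<le> 17 / 16"
    and G[measurable]: "G \<in> sets M" and Gprob: "card I * (1 - prob G) \<le> 1 / 6"
    and Z: "Z\<^sub>0 \<in> sets (PiM I (\<lambda>_. M))" "Z\<^sub>1 \<in> sets (PiM I (\<lambda>_. M))"
    and cover: "Pi\<^sub>E I (\<lambda>_. G) \<subseteq> Z\<^sub>0 \<union> Z\<^sub>1"
  shows "measure (PiM I (\<lambda>_. density M (\<lambda>x. ennreal (1 + g x)))) Z\<^sub>0 +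
         measure (PiM I (\<lambda>_. density M (\<lambda>x. ennreal (1 - g x)))) Z\<^sub>1 \<ge> 1 / 3"
proof -
  interpret B: finite_product_prob_space "\<lambda>_. M" I by unfold_locales fact
  let ?R = "PiM I (\<lambda>_. M)"
  have 0: "measure (PiM I (\<lambda>_. density M (\<lambda>x. ennreal (1 + g x)))) Z\<^sub>0 \<ge> measure ?R Z\<^sub>0 - 1 / 4"
    by (rule prob_PiM_density_ge) (use assms in auto)
  have "measure (PiM I (\<lambda>_. density M (\<lambda>x. ennreal (1 + - g x)))) Z\<^sub>1 \<ge> measure ?R Z\<^sub>1 - 1 / 4"
    by (rule prob_PiM_density_ge[where \<beta>=\<beta>]) (use assms in auto)
  then have 1: "measure (PiM I (\<lambda>_. density M (\<lambda>x. ennreal (1 - g x)))) Z\<^sub>1 \<ge> measure ?R Z\<^sub>1 - 1 / 4"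
    by simp
  have "measure ?R (Pi\<^sub>E I (\<lambda>_. G)) = prob G ^ card I"
    by (subst B.finite_measure_PiM_emb) auto
  \<comment> \<open>Bernoulli's inequality acts as a union bound over the draws that miss
    \<open>G\<close>.\<close>
  also have "\<dots> \<ge> 1 + card I * (prob G - 1)"
    using Bernoulli_inequality[of "prob G - 1" "card I"] by simp
  finally have "measure ?R (Pi\<^sub>E I (\<lambda>_. G)) \<ge> 5 / 6"
    using Gprob by (simp add: algebra_simps)
  also have "measure ?R (Pi\<^sub>E I (\<lambda>_. G)) \<le> measure ?R (Z\<^sub>0 \<union> Z\<^sub>1)"
    using Z cover by (intro B.P.finite_measure_mono) auto
  also have "\<dots> \<le> measure ?R Z\<^sub>0 + measure ?R Z\<^sub>1"
    using Z by (intro measure_Un_le) auto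
  finally show ?thesis using 0 1 by linarith
qed

section \<open>Product kernels and the joint law of index, seed and samples\<close>

lemma measurable_PiM_kernel:
  assumes fin: "finite I" and P: "P \<in> Q \<rightarrow>\<^sub>M prob_algebra S"
  shows "(\<lambda>v. PiM I (\<lambda>_. P v)) \<in> Q \<rightarrow>\<^sub>M prob_algebra (PiM I (\<lambda>_. S))"
proof -
  have prob: "prob_space (P v)" and setsP: "sets (P v) = sets S" if "v \<in> space Q" for v
    using measurable_space[OF P that] by (auto simp: space_prob_algebra)
  show ?thesis
  proof (rule measurable_prob_algebra_generated)
    show "sets (PiM I (\<lambda>_. S)) = sigma_sets (\<Pi>\<^sub>E i\<in>I. space S) (prod_algebra I (\<lambda>_. S))"
      by (rule sets_PiM)
    show "Int_stable (prod_algebra I (\<lambda>_. S))"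
      by (rule Int_stable_prod_algebra)
    show "prod_algebra I (\<lambda>_. S) \<subseteq> Pow (\<Pi>\<^sub>E i\<in>I. space S)"
      by (rule prod_algebra_sets_into_space)
    show "prob_space (PiM I (\<lambda>_. P v))" if "v \<in> space Q" for v
      using prob that by (intro prob_space_PiM)
    show "sets (PiM I (\<lambda>_. P v)) = sets (PiM I (\<lambda>_. S))" if "v \<in> space Q" for v
      using setsP that by (intro sets_PiM_cong) auto
    \<comment> \<open>On a generating box the mass is a finite product of functions measurable in
      \<open>v\<close>; an intersection-stable generator suffices.\<close>
    fix A assume "A \<in> prod_algebra I (\<lambda>_. S)"
    then obtain E where A: "A = Pi\<^sub>E I E" and E: "\<And>i. i \<in> I \<Longrightarrow> E i \<in> sets S"
      by (auto simp: prod_algebra_eq_finite[OF fin])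
    have "emeasure (PiM I (\<lambda>_. P v)) A = (\<Prod>i\<in>I. emeasure (P v) (E i))" if "v \<in> space Q" for v
    proof -
      interpret prob_space "P v" by (rule prob[OF that])
      interpret product_prob_space "\<lambda>_. P v" I by unfold_locales
      show ?thesis
        unfolding A using fin E setsP[OF that] by (intro emeasure_PiM) auto
    qed
    moreover have "(\<lambda>v. \<Prod>i\<in>I. emeasure (P v) (E i)) \<in> borel_measurable Q"
      using E by (intro borel_measurable_prod_ennreal measurable_emeasure_kernel[OF measurable_prob_algebraD[OF P]])
    ultimately show "(\<lambda>v. emeasure (PiM I (\<lambda>_. P v)) A) \<in> borel_measurable Q"
      by (simp cong: measurable_cong)
  qed
qed

text \<open>Unfolds the joint law into iterated integrals, so that the testing bound can be applied
  for fixed \<open>v\<close> and fixed seed \<open>u\<close>, where the method is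
  deterministic.\<close>

lemma emeasure_sampling_law:
  assumes Q: "prob_space Q" and P: "P \<in> Q \<rightarrow>\<^sub>M prob_algebra S"
    and X: "X \<in> sets (Q \<Otimes>\<^sub>M (borel \<Otimes>\<^sub>M PiM {1..n} (\<lambda>_. S)))"
  shows "emeasure (sampling_law Q S P n) X =
    (\<integral>\<^sup>+v. \<integral>\<^sup>+u. emeasure (PiM {1..n} (\<lambda>_. P v)) {s. (v, u, s) \<in> X} \<partial>uniform_measure lborel {0..1} \<partial>Q)"
    and "prob_space (sampling_law Q S P n)"
    and "sets (sampling_law Q S P n) = sets (Q \<Otimes>\<^sub>M (borel \<Otimes>\<^sub>M PiM {1..n} (\<lambda>_. S)))"
proof -
  let ?U = "uniform_measure lborel {0..1::real}"
  let ?T = "borel \<Otimes>\<^sub>M PiM {1..n} (\<lambda>_. S)"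
  let ?K = "\<lambda>v. ?U \<Otimes>\<^sub>M PiM {1..n} (\<lambda>_. P v)"
  interpret U: prob_space ?U
    by (rule prob_space_uniform_measure) auto
  have [measurable]: "(\<lambda>v. ?U) \<in> Q \<rightarrow>\<^sub>M prob_algebra borel"
    by (rule measurable_const) (simp add: space_prob_algebra U.prob_space_axioms)
  have [measurable]: "(\<lambda>v. PiM {1..n} (\<lambda>_. P v)) \<in> Q \<rightarrow>\<^sub>M prob_algebra (PiM {1..n} (\<lambda>_. S))"
    by (rule measurable_PiM_kernel[OF _ P]) simp
  have K: "?K \<in> Q \<rightarrow>\<^sub>M prob_algebra ?T"
    by measurable
  have D: "(\<lambda>v. distr (?K v) (Q \<Otimes>\<^sub>M ?T) (Pair v)) \<in> Q \<rightarrow>\<^sub>M prob_algebra (Q \<Otimes>\<^sub>M ?T)"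
    by (rule measurable_distr_prob_space2[OF K]) simp
  have Qs: "Q \<in> space (prob_algebra Q)" using Q by (simp add: space_prob_algebra)
  show "prob_space (sampling_law Q S P n)"
    unfolding sampling_law_def by (rule prob_space_bind'[OF Qs D])
  show "sets (sampling_law Q S P n) = sets (Q \<Otimes>\<^sub>M ?T)"
    unfolding sampling_law_def by (rule sets_bind'[OF Qs D])
  have "emeasure (sampling_law Q S P n) X = (\<integral>\<^sup>+v. emeasure (distr (?K v) (Q \<Otimes>\<^sub>M ?T) (Pair v)) X \<partial>Q)"
    unfolding sampling_law_def by (rule emeasure_bind_prob_algebra[OF Qs D X])
  also have "\<dots> = (\<integral>\<^sup>+v. \<integral>\<^sup>+u. emeasure (PiM {1..n} (\<lambda>_. P v)) {s. (v, u, s) \<in> X} \<partial>?U \<partial>Q)"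
  proof (rule nn_integral_cong)
    fix v assume v: "v \<in> space Q"
    have sets_P: "sets (P v) = sets S" and "prob_space (P v)"
      using measurable_space[OF P v] by (auto simp: space_prob_algebra)
    then interpret Pv: prob_space "PiM {1..n} (\<lambda>_. P v)"
      by (intro prob_space_PiM)
    have sets_PP: "sets (PiM {1..n} (\<lambda>_. P v)) = sets (PiM {1..n} (\<lambda>_. S))"
      using sets_P by (intro sets_PiM_cong) auto
    have sets_K: "sets (?K v) = sets ?T"
      using sets_PP by (intro sets_pair_measure_cong) auto
    have Pv: "Pair v \<in> ?K v \<rightarrow>\<^sub>M Q \<Otimes>\<^sub>M ?T"
      using v by (subst measurable_cong_sets[OF sets_K refl]) simp
    have Xv: "Pair v -` X \<in> sets (?K v)"
      using sets_Pair1[OF X, of v] sets_K by simp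
    have "Pair v -` X \<subseteq> space (?K v)" using sets.sets_into_space[OF Xv] .
    then have "emeasure (distr (?K v) (Q \<Otimes>\<^sub>M ?T) (Pair v)) X = emeasure (?K v) (Pair v -` X)"
      using X by (subst emeasure_distr[OF Pv]) (auto simp: Int_absorb2)
    also have "\<dots> = (\<integral>\<^sup>+u. emeasure (PiM {1..n} (\<lambda>_. P v)) (Pair u -` Pair v -` X) \<partial>?U)"
      by (rule Pv.emeasure_pair_measure_alt[OF Xv])
    finally show "emeasure (distr (?K v) (Q \<Otimes>\<^sub>M ?T) (Pair v)) X =
        (\<integral>\<^sup>+u. emeasure (PiM {1..n} (\<lambda>_. P v)) {s. (v, u, s) \<in> X} \<partial>?U)"
      by (simp add: vimage_def)
  qed
  finally show "emeasure (sampling_law Q S P n) X =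
    (\<integral>\<^sup>+v. \<integral>\<^sup>+u. emeasure (PiM {1..n} (\<lambda>_. P v)) {s. (v, u, s) \<in> X} \<partial>?U \<partial>Q)" .
qed

subsection \<open>The hard instance\<close>

lemma measurable_pair_countable_snd:
  fixes f :: "'a \<Rightarrow> 'z::countable \<Rightarrow> 'b"
  assumes "\<And>z. (\<lambda>v. f v z) \<in> Q \<rightarrow>\<^sub>M N" and "sets R = UNIV"
  shows "(\<lambda>(v, z). f v z) \<in> Q \<Otimes>\<^sub>M R \<rightarrow>\<^sub>M N"
proof -
  have [measurable_cong]: "sets R = sets (count_space UNIV)" using assms(2) by simp
  note assms(1)[measurable]
  have "(\<lambda>p. (\<lambda>z p. f (fst p) z) (snd p) p) \<in> Q \<Otimes>\<^sub>M R \<rightarrow>\<^sub>M N"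
    by (rule measurable_compose_countable) measurable
  then show ?thesis by (simp add: case_prod_beta')
qed

lemma map_pmf_Not_fair_coin: "map_pmf Not (bernoulli_pmf (1 / 2)) = bernoulli_pmf (1 / 2)"
  unfolding bernoulli_pmf_half_conv_pmf_of_set
  by (rule map_pmf_of_set_bij_betw) (auto intro!: bij_betw_byWitness[where f'=Not])

abbreviation pm :: "bool \<Rightarrow> real" where
  "pm b \<equiv> (if b then 1 else - 1)"

section \<open>Nested intervals and the kinked loss\<close>

definition radius :: "nat \<Rightarrow> real" where
  "radius k = (1 / 4) ^ k"

text \<open>An interval with centre \<open>c\<close> and radius \<open>r\<close> has the children
  \<open>[c + r/2, c + r]\<close> and \<open>[c - r, c - r/2]\<close>: their centres lie at distance
  \<open>3/4 * r\<close> from \<open>c\<close> and their radius is \<open>r/4\<close>.\<close>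

definition center :: "(nat \<Rightarrow> real) \<Rightarrow> nat \<Rightarrow> real" where
  "center \<sigma> k = (\<Sum>j<k. \<sigma> j * (3 / 4 * radius j))"

definition limit :: "(nat \<Rightarrow> real) \<Rightarrow> real" where
  "limit \<sigma> = (\<Sum>j. \<sigma> j * (3 / 4 * radius j))"

text \<open>
  A sample at level \<open>k\<close> with centre \<open>c\<close> and radius \<open>r\<close> is encoded as \<open>s 0 = c \<plusminus> r\<close>, \<open>s 1 = c - r / 2\<close>,
  \<open>s 2 = c + r / 2\<close>, \<open>s 3 = \<beta> k\<close>; the truncation of \<open>s 3\<close> to \<open>[0,1]\<close> only serves the
  Lipschitz bound at sequences that are never sampled. With \<open>P(c + r) = (1 + \<beta> k) / 2\<close> the
  two kinks at \<open>c \<plusminus> r / 2\<close> make the expectation constant on \<open>[c + r / 2, c + r]\<close>, which leaves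
  room for all later levels.
\<close>

definition kinked :: "real \<Rightarrow> (nat \<Rightarrow> real) \<Rightarrow> real" where
  "kinked x s = \<bar>x - s 0\<bar> / 2 + max 0 (min 1 (s 3)) / 4 * (\<bar>x - s 1\<bar> + \<bar>x - s 2\<bar>)"

lemma radius_pos: "0 < radius k"
  by (simp add: radius_def)

lemma radius_le_1: "radius k \<le> 1"
  by (simp add: radius_def power_le_one)

lemma radius_Suc: "radius (Suc k) = radius k / 4"
  by (simp add: radius_def)

lemma center_Suc: "center \<sigma> (Suc k) = center \<sigma> k + \<sigma> k * (3 / 4 * radius k)"
  by (simp add: center_def)

lemma center_cong: "(\<And>j. j < k \<Longrightarrow> \<sigma> j = \<tau> j) \<Longrightarrow> center \<sigma> k = center \<tau> k"
  by (simp add: center_def)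

text \<open>From index \<open>k\<close> on, the series is dominated by a geometric series with sum
  exactly \<open>radius k\<close>; thus the limit point lies in every interval of its path.\<close>

lemma abs_limit_center_le:
  assumes "\<And>j. \<bar>\<sigma> j\<bar> \<le> 1"
  shows "\<bar>limit \<sigma> - center \<sigma> k\<bar> \<le> radius k"
proof -
  have bound: "norm (\<sigma> j * (3 / 4 * radius j)) \<le> 3 / 4 * (1 / 4) ^ j" for j
    using assms[of j] by (simp add: abs_mult radius_def mult_left_le_one_le)
  have geo: "(\<lambda>j. 3 / 4 * (1 / 4 :: real) ^ (j + k)) sums (1 / 4) ^ k"
  proof -
    have "(\<lambda>j. (3 / 4 * (1 / 4) ^ k) * (1 / 4 :: real) ^ j) sums ((3 / 4 * (1 / 4) ^ k) * (1 / (1 - 1 / 4)))"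
      by (intro sums_mult geometric_sums) simp
    then show ?thesis by (simp add: power_add mult_ac)
  qed
  have summ: "summable (\<lambda>j. \<sigma> j * (3 / 4 * radius j))"
    using bound by (intro summable_comparison_test[OF _ summable_mult[OF summable_geometric[of "1 / 4 :: real"], of "3 / 4"]])
       auto
  have "limit \<sigma> - center \<sigma> k = (\<Sum>j. \<sigma> (j + k) * (3 / 4 * radius (j + k)))"
    using suminf_split_initial_segment[OF summ, of k] by (simp add: limit_def center_def)
  also have "norm \<dots> \<le> (\<Sum>j. 3 / 4 * (1 / 4) ^ (j + k))"
    using bound sums_summable[OF geo] by (rule norm_suminf_le)
  also have "\<dots> = radius k"
    using sums_unique[OF geo] by (simp add: radius_def)
  finally show ?thesis by simp
qed

lemma abs_center_le:
  assumes "\<And>j. \<bar>\<sigma> j\<bar> \<le> 1"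
  shows "\<bar>center \<sigma> k\<bar> \<le> 1"
proof -
  \<comment> \<open>Strengthened for the induction: the whole level-\<open>k\<close> interval stays
    in [-1, 1]. A step moves the centre by at most \<open>3/4 * radius k\<close>, exactly what the
    shrinking radius frees.\<close>
  have "\<bar>center \<sigma> k\<bar> \<le> 1 - radius k"
  proof (induction k)
    case 0
    show ?case by (simp add: center_def radius_def)
  next
    case (Suc k)
    have "\<bar>\<sigma> k * (3 / 4 * radius k)\<bar> \<le> 3 / 4 * radius k"
      using assms[of k] radius_pos[of k] by (simp add: abs_mult mult_left_le_one_le)
    then show ?case using Suc by (simp add: center_Suc radius_Suc)
  qed
  then show ?thesis using radius_pos[of k] by linarith
qed

lemma kinked_convex: "convex_on UNIV (\<lambda>x. kinked x s)"
proof -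
  have "convex_on UNIV (\<lambda>x. \<bar>x - c\<bar>)" for c :: real
    using convex_on_dist[of UNIV c] by (simp add: dist_real_def abs_minus_commute)
  then show ?thesis
    unfolding kinked_def by (intro convex_on_add convex_on_cmul convex_on_cdiv) auto
qed

text \<open>The term of \<open>s 0\<close> contributes slope at most 1/2, and the two kinks, whose
  truncated weight is at most 1, contribute at most 1/4 each.\<close>

lemma kinked_lipschitz: "1-lipschitz_on UNIV (\<lambda>x. kinked x s)"
proof (rule lipschitz_onI)
  fix x y :: real
  define t where "t = max 0 (min 1 (s 3))"
  have t: "0 \<le> t" "t \<le> 1" by (auto simp: t_def)
  have *: "\<bar>\<bar>x - c\<bar> - \<bar>y - c\<bar>\<bar> \<le> \<bar>x - y\<bar>" for c :: real by linarith
  define d where "d j = \<bar>x - s j\<bar> - \<bar>y - s j\<bar>" for j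
  have d: "\<bar>d j\<bar> \<le> \<bar>x - y\<bar>" for j unfolding d_def by (rule *)
  have "kinked x s - kinked y s = d 0 / 2 + t * ((d 1 + d 2) / 4)"
    by (simp add: kinked_def t_def[symmetric] d_def field_simps)
  moreover have "\<bar>t * ((d 1 + d 2) / 4)\<bar> \<le> 1 * (\<bar>x - y\<bar> / 2)"
    unfolding abs_mult using t abs_triangle_ineq[of "d 1" "d 2"] d[of 1] d[of 2]
    by (intro mult_mono) auto
  ultimately show "dist (kinked x s) (kinked y s) \<le> 1 * dist x y"
    using d[of 0] abs_triangle_ineq[of "d 0 / 2" "t * ((d 1 + d 2) / 4)"] by (simp add: dist_real_def)
qed simp

section \<open>The law of a single sample\<close>

locale hard_instance =
  fixes W :: "nat pmf" and \<beta> :: "nat \<Rightarrow> real"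
  assumes \<beta>_nonneg: "0 \<le> \<beta> k" and \<beta>_le_1: "\<beta> k \<le> 1"
begin

definition latent :: "(nat \<times> bool) pmf" where
  "latent = pair_pmf W (bernoulli_pmf (1 / 2))"

text \<open>The bias of the coin enters as a density over a fair coin, so the laws for all
  \<open>\<sigma>\<close> share one dominating measure. Real-valued \<open>\<sigma>\<close> admits
  the value 0, an unbiased level, as the midpoint between the two signs.\<close>

definition tilt :: "(nat \<Rightarrow> real) \<Rightarrow> nat \<times> bool \<Rightarrow> real" where
  "tilt \<sigma> z = 1 + \<beta> (fst z) * \<sigma> (fst z) * pm (snd z)"

definition sample :: "(nat \<Rightarrow> real) \<Rightarrow> nat \<times> bool \<Rightarrow> nat \<Rightarrow> real" where
  "sample \<sigma> z j =
     (if j = 0 then center \<sigma> (fst z) + pm (snd z) * radius (fst z)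
      else if j = 1 then center \<sigma> (fst z) - radius (fst z) / 2
      else if j = 2 then center \<sigma> (fst z) + radius (fst z) / 2
      else \<beta> (fst z))"

abbreviation sample_space :: "(nat \<Rightarrow> real) measure" where
  "sample_space \<equiv> PiM UNIV (\<lambda>_. borel)"

definition tilted :: "(nat \<Rightarrow> real) \<Rightarrow> (nat \<times> bool) measure" where
  "tilted \<sigma> = density (measure_pmf latent) (\<lambda>z. ennreal (tilt \<sigma> z))"

definition sample_law :: "(nat \<Rightarrow> real) \<Rightarrow> (nat \<Rightarrow> real) measure" where
  "sample_law \<sigma> = distr (tilted \<sigma>) sample_space (sample \<sigma>)"

lemma integral_latent_flip:
  "measure_pmf.expectation latent (\<lambda>z. \<phi> (fst z) (\<not> snd z)) =
   (measure_pmf.expectation latent (\<lambda>z. \<phi> (fst z) (snd z)) :: real)"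
proof -
  have "map_pmf (\<lambda>(k, b). (id k, \<not> b)) latent = latent"
    unfolding latent_def by (subst map_pair) (simp add: pmf.map_id map_pmf_Not_fair_coin)
  then have "measure_pmf.expectation latent (\<lambda>z. \<phi> (fst z) (snd z)) =
      measure_pmf.expectation (map_pmf (\<lambda>(k, b). (id k, \<not> b)) latent) (\<lambda>z. \<phi> (fst z) (snd z))"
    by simp
  then show ?thesis by (simp add: case_prod_beta')
qed

lemma abs_tilt_le:
  assumes "\<And>j. \<bar>\<sigma> j\<bar> \<le> 1"
  shows "\<bar>\<beta> k * \<sigma> k * pm b\<bar> \<le> \<beta> k"
  using assms[of k] \<beta>_nonneg[of k] by (simp add: abs_mult mult_left_le)

lemma tilt_bounds:
  assumes "\<And>j. \<bar>\<sigma> j\<bar> \<le> 1"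
  shows "0 \<le> tilt \<sigma> z" "tilt \<sigma> z \<le> 2"
  using abs_tilt_le[of \<sigma> "fst z" "snd z", OF assms] \<beta>_le_1[of "fst z"] unfolding tilt_def by linarith+

text \<open>The integrand is odd in the coin, so flipping the fair coin shows that its expectation
  equals its own negative.\<close>

lemma tilt_mean: "measure_pmf.expectation latent (\<lambda>z. \<beta> (fst z) * \<sigma> (fst z) * pm (snd z)) = 0"
proof -
  have "measure_pmf.expectation latent (\<lambda>z. \<beta> (fst z) * \<sigma> (fst z) * pm (snd z)) =
      measure_pmf.expectation latent (\<lambda>z. - (\<beta> (fst z) * \<sigma> (fst z) * pm (snd z)))"
    by (subst integral_latent_flip[where \<phi>="\<lambda>k b. \<beta> k * \<sigma> k * pm b", symmetric])
      (intro Bochner_Integration.integral_cong refl, auto)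
  then show ?thesis by simp
qed

lemma prob_space_tilted:
  assumes "\<And>j. \<bar>\<sigma> j\<bar> \<le> 1"
  shows "prob_space (tilted \<sigma>)"
  unfolding tilted_def tilt_def
proof (rule measure_pmf.prob_space_density_centred)
  show "\<bar>\<beta> (fst z) * \<sigma> (fst z) * pm (snd z)\<bar> \<le> 1" for z
    using abs_tilt_le[of \<sigma> "fst z" "snd z", OF assms] \<beta>_le_1[of "fst z"] by linarith
qed (simp_all add: tilt_mean)

lemma sets_tilted: "sets (tilted \<sigma>) = UNIV"
  by (simp add: tilted_def)

lemma space_tilted: "space (tilted \<sigma>) = UNIV"
  by (simp add: tilted_def)

lemma sample_measurable: "sample \<sigma> \<in> tilted \<sigma> \<rightarrow>\<^sub>M sample_space"
  by (auto simp: measurable_def sets_tilted space_tilted space_PiM)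

lemma prob_space_sample_law:
  assumes "\<And>j. \<bar>\<sigma> j\<bar> \<le> 1"
  shows "prob_space (sample_law \<sigma>)"
  unfolding sample_law_def
  by (rule prob_space.prob_space_distr[OF prob_space_tilted[OF assms] sample_measurable])

lemma kinked_measurable [measurable]: "kinked x \<in> borel_measurable sample_space"
  unfolding kinked_def by measurable

lemma kinked_sample_bounds:
  assumes "\<And>j. \<bar>\<sigma> j\<bar> \<le> 1"
  shows "\<bar>kinked x (sample \<sigma> z)\<bar> \<le> \<bar>x\<bar> + 2"
proof -
  obtain k b where z: "z = (k, b)" by (cases z)
  have \<beta>: "max 0 (min 1 (\<beta> k)) = \<beta> k" using \<beta>_nonneg[of k] \<beta>_le_1[of k] by simp
  have c: "\<bar>center \<sigma> k\<bar> \<le> 1" by (rule abs_center_le[OF assms])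
  have r: "0 \<le> radius k" "radius k \<le> 1" using radius_pos[of k] radius_le_1[of k] by auto
  let ?m = "\<bar>x - (center \<sigma> k - radius k / 2)\<bar> + \<bar>x - (center \<sigma> k + radius k / 2)\<bar>"
  have "?m \<le> 2 * \<bar>x\<bar> + 4" using c r by linarith
  then have "\<beta> k * ?m \<le> 1 * (2 * \<bar>x\<bar> + 4)"
    using \<beta>_nonneg[of k] \<beta>_le_1[of k] by (intro mult_mono) auto
  moreover have "\<bar>x - (center \<sigma> k + pm b * radius k)\<bar> \<le> \<bar>x\<bar> + 2" using c r by (auto split: if_splits)
  moreover have "0 \<le> \<beta> k * ?m" using \<beta>_nonneg[of k] by auto
  ultimately show ?thesis
    by (simp add: z kinked_def sample_def \<beta>)
qed

lemma integrable_latent: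
  assumes "\<And>z. \<bar>\<phi> z\<bar> \<le> (B::real)"
  shows "integrable (measure_pmf latent) \<phi>"
  by (rule measure_pmf.integrable_const_bound[where B=B]) (use assms in auto)

lemma integrable_tilt_kinked:
  assumes "\<And>j. \<bar>\<sigma> j\<bar> \<le> 1"
  shows "integrable (measure_pmf latent) (\<lambda>z. tilt \<sigma> z * kinked x (sample \<sigma> z))"
proof (rule integrable_latent)
  show "\<bar>tilt \<sigma> z * kinked x (sample \<sigma> z)\<bar> \<le> 2 * (\<bar>x\<bar> + 2)" for z
    unfolding abs_mult using tilt_bounds[of \<sigma> z, OF assms] kinked_sample_bounds[of \<sigma> x z, OF assms]
    by (intro mult_mono) auto
qed

lemma objective_sample_law:
  assumes "\<And>j. \<bar>\<sigma> j\<bar> \<le> 1"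
  shows "objective kinked (sample_law \<sigma>) x =
    measure_pmf.expectation latent (\<lambda>z. tilt \<sigma> z * kinked x (sample \<sigma> z))"
proof -
  have "objective kinked (sample_law \<sigma>) x = (\<integral>z. kinked x (sample \<sigma> z) \<partial>tilted \<sigma>)"
    unfolding objective_def sample_law_def by (rule integral_distr[OF sample_measurable]) measurable
  also have "\<dots> = measure_pmf.expectation latent (\<lambda>z. tilt \<sigma> z * kinked x (sample \<sigma> z))"
    unfolding tilted_def using tilt_bounds[OF assms] by (subst integral_real_density) auto
  finally show ?thesis .
qed

lemma integrable_sample_law:
  assumes "\<And>j. \<bar>\<sigma> j\<bar> \<le> 1"
  shows "integrable (sample_law \<sigma>) (kinked x)"
proof -
  have "integrable (tilted \<sigma>) (\<lambda>z. kinked x (sample \<sigma> z))"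
    unfolding tilted_def using tilt_bounds[OF assms] integrable_tilt_kinked[OF assms]
    by (subst integrable_density) auto
  then show ?thesis
    unfolding sample_law_def by (subst integrable_distr_eq[OF sample_measurable]) auto
qed

section \<open>Excess loss, level by level\<close>

definition level_gap :: "(nat \<Rightarrow> real) \<Rightarrow> real \<Rightarrow> real \<Rightarrow> nat \<Rightarrow> bool \<Rightarrow> real" where
  "level_gap \<sigma> x y k b = tilt \<sigma> (k, b) * (kinked x (sample \<sigma> (k, b)) - kinked y (sample \<sigma> (k, b)))"

text \<open>Only the sum over both coin values has a sign. With \<open>u\<close> and
  \<open>w\<close> the positions of \<open>x\<close> and \<open>y\<close> relative to the centre,
  oriented by \<open>\<sigma> k\<close>, the sum is \<open>?F u - ?F w\<close> for one convex
  function that has its minimum \<open>r\<close> on the selected child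
  \<open>[r/2, r]\<close>.\<close>

lemma level_gap_sum:
  assumes "\<bar>\<sigma> k\<bar> = 1" and y: "\<bar>y - center \<sigma> (Suc k)\<bar> \<le> radius k / 4"
  shows "0 \<le> level_gap \<sigma> x y k True + level_gap \<sigma> x y k False"
    and "\<sigma> k * (x - center \<sigma> k) \<le> 0 \<Longrightarrow>
      \<beta> k * radius k / 2 \<le> level_gap \<sigma> x y k True + level_gap \<sigma> x y k False"
proof -
  define c r t where "c = center \<sigma> k" and "r = radius k" and "t = \<beta> k"
  define u w where "u = \<sigma> k * (x - c)" and "w = \<sigma> k * (y - c)"
  have \<sigma>: "\<sigma> k = 1 \<or> \<sigma> k = - 1" using assms(1) by linarith
  have t: "max 0 (min 1 t) = t" "0 \<le> t" "t \<le> 1"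
    using \<beta>_nonneg[of k] \<beta>_le_1[of k] by (simp_all add: t_def)
  have r: "0 < r" by (simp add: r_def radius_pos)
  have "y - c - \<sigma> k * (3 / 4 * r) \<le> r / 4" "- (y - c - \<sigma> k * (3 / 4 * r)) \<le> r / 4"
    using y unfolding center_Suc c_def r_def by linarith+
  then have w: "r / 2 \<le> w" "w \<le> r"
    using \<sigma> by (auto simp: w_def)
  let ?F = "\<lambda>u. (1 + t) * \<bar>u - r\<bar> / 2 + (1 - t) * \<bar>u + r\<bar> / 2 + t / 2 * (\<bar>u - r / 2\<bar> + \<bar>u + r / 2\<bar>)"
  have eq: "level_gap \<sigma> x y k True + level_gap \<sigma> x y k False = ?F u - ?F w"
    using \<sigma>
  proof
    assume s: "\<sigma> k = 1"
    show ?thesis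
      by (simp add: level_gap_def tilt_def kinked_def sample_def s t flip: c_def r_def t_def)
         (simp add: u_def w_def s algebra_simps add_divide_distrib diff_divide_distrib)
  next
    assume s: "\<sigma> k = - 1"
    \<comment> \<open>Orienting by a negative sign reflects about \<open>c\<close>, so the two coin
      values exchange their roles.\<close>
    have a: "\<bar>u - q\<bar> = \<bar>x - (c - q)\<bar>" "\<bar>u + q\<bar> = \<bar>x - (c + q)\<bar>"
      "\<bar>w - q\<bar> = \<bar>y - (c - q)\<bar>" "\<bar>w + q\<bar> = \<bar>y - (c + q)\<bar>" for q
      using s by (auto simp: u_def w_def)
    show ?thesis
      unfolding a
      by (simp add: level_gap_def tilt_def kinked_def sample_def s t flip: c_def r_def t_def)
         (simp add: algebra_simps add_divide_distrib diff_divide_distrib)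
  qed
  have Fw: "?F w = r"
  proof -
    have "\<bar>w - r\<bar> = r - w" "\<bar>w + r\<bar> = w + r" "\<bar>w - r / 2\<bar> = w - r / 2" "\<bar>w + r / 2\<bar> = w + r / 2"
      using w r by auto
    then show ?thesis by (simp add: field_simps)
  qed
  \<comment> \<open>The outer absolute values are replaced by linear minorants, exact on
    \<open>[-r, r]\<close>. They add up to \<open>r - t * u\<close>, and the two kinks have to
    compensate the slope \<open>- t\<close>.\<close>
  have lower: "(1 + t) * (r - u) / 2 + (1 - t) * (u + r) / 2 + t / 2 * (\<bar>u - r / 2\<bar> + \<bar>u + r / 2\<bar>) \<le> ?F u"
    using t by (intro add_mono divide_right_mono mult_left_mono) auto
  have flat: "(1 + t) * (r - u) / 2 + (1 - t) * (u + r) / 2 = r - t * u"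
    by (simp add: field_simps)
  have "t / 2 * (2 * u) \<le> t / 2 * (\<bar>u - r / 2\<bar> + \<bar>u + r / 2\<bar>)"
    using t by (intro mult_left_mono) auto
  then show "0 \<le> level_gap \<sigma> x y k True + level_gap \<sigma> x y k False"
    unfolding eq Fw using lower flat by simp
  assume "\<sigma> k * (x - center \<sigma> k) \<le> 0"
  then have "u \<le> 0" by (simp add: u_def c_def)
  \<comment> \<open>The distances to the two kinks sum to at least \<open>r\<close>, and
    \<open>2 * u + r \<le> r\<close> on the wrong side.\<close>
  then have "t / 2 * (2 * u + r) \<le> t / 2 * (\<bar>u - r / 2\<bar> + \<bar>u + r / 2\<bar>)"
    using t by (intro mult_left_mono) auto
  then have "t * r / 2 \<le> ?F u - ?F w"
    unfolding Fw using lower flat by (simp add: algebra_simps)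
  then show "\<beta> k * radius k / 2 \<le> level_gap \<sigma> x y k True + level_gap \<sigma> x y k False"
    unfolding eq by (simp add: t_def r_def)
qed

text \<open>The limit point lies in the selected child at every level, so no level contributes
  negatively to the excess, and a single level may be kept. The constant \<open>1/4\<close> is the
  \<open>1/2\<close> of a level halved by averaging over the coin.\<close>

lemma objective_gap:
  assumes \<sigma>: "\<And>j. \<bar>\<sigma> j\<bar> = 1"
  shows "objective kinked (sample_law \<sigma>) (limit \<sigma>) \<le> objective kinked (sample_law \<sigma>) x"
    and "\<sigma> i * (x - center \<sigma> i) \<le> 0 \<Longrightarrow>
      pmf W i * (\<beta> i * radius i / 4) \<le>
        objective kinked (sample_law \<sigma>) x - objective kinked (sample_law \<sigma>) (limit \<sigma>)"
proof -
  let ?E = "measure_pmf.expectation latent"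
  let ?g = "level_gap \<sigma> x (limit \<sigma>)"
  have \<sigma>1: "\<And>j. \<bar>\<sigma> j\<bar> \<le> 1" using \<sigma> by (simp add: eq_refl)
  have near: "\<bar>limit \<sigma> - center \<sigma> (Suc k)\<bar> \<le> radius k / 4" for k
    using abs_limit_center_le[of \<sigma> "Suc k", OF \<sigma>1] by (simp add: radius_Suc)
  have int: "integrable (measure_pmf latent) (\<lambda>z. ?g (fst z) (snd z))"
    using integrable_tilt_kinked[OF \<sigma>1]
    by (simp add: level_gap_def right_diff_distrib)
  have bnd: "\<bar>?g (fst z) (\<not> snd z)\<bar> \<le> 2 * ((\<bar>x\<bar> + 2) + (\<bar>limit \<sigma>\<bar> + 2))" for z
    unfolding level_gap_def abs_mult
    using tilt_bounds[of \<sigma> "(fst z, \<not> snd z)", OF \<sigma>1]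
      kinked_sample_bounds[of \<sigma> x "(fst z, \<not> snd z)", OF \<sigma>1]
      kinked_sample_bounds[of \<sigma> "limit \<sigma>" "(fst z, \<not> snd z)", OF \<sigma>1]
    by (intro mult_mono) auto
  have int': "integrable (measure_pmf latent) (\<lambda>z. ?g (fst z) (\<not> snd z))"
    by (rule integrable_latent[OF bnd])
  have "objective kinked (sample_law \<sigma>) x - objective kinked (sample_law \<sigma>) (limit \<sigma>) =
      ?E (\<lambda>z. ?g (fst z) (snd z))"
    using integrable_tilt_kinked[OF \<sigma>1]
    by (simp add: objective_sample_law[OF \<sigma>1] level_gap_def right_diff_distrib)
  \<comment> \<open>Averaging each outcome with its flipped coin makes the integrand depend on the
    level alone, and the expectation reduces to one over \<open>W\<close>.\<close>
  also have "\<dots> = ?E (\<lambda>z. (?g (fst z) (snd z) + ?g (fst z) (\<not> snd z)) / 2)"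
    using int int' integral_latent_flip[of ?g] by simp
  also have "(\<lambda>z. (?g (fst z) (snd z) + ?g (fst z) (\<not> snd z)) / 2) =
      (\<lambda>z. (?g (fst z) True + ?g (fst z) False) / 2)"
  proof
    fix z :: "nat \<times> bool"
    show "(?g (fst z) (snd z) + ?g (fst z) (\<not> snd z)) / 2 = (?g (fst z) True + ?g (fst z) False) / 2"
      by (cases "snd z") auto
  qed
  also have "?E (\<lambda>z. (?g (fst z) True + ?g (fst z) False) / 2) =
      measure_pmf.expectation W (\<lambda>k. (?g k True + ?g k False) / 2)"
    unfolding latent_def by (rule expectation_pair_pmf_fst)
  finally have gap: "objective kinked (sample_law \<sigma>) x - objective kinked (sample_law \<sigma>) (limit \<sigma>) =
      measure_pmf.expectation W (\<lambda>k. (?g k True + ?g k False) / 2)" .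
  have intW: "integrable (measure_pmf W) (\<lambda>k. (?g k True + ?g k False) / 2)"
  proof (rule measure_pmf.integrable_const_bound)
    show "AE k in measure_pmf W. norm ((?g k True + ?g k False) / 2) \<le> 2 * ((\<bar>x\<bar> + 2) + (\<bar>limit \<sigma>\<bar> + 2))"
      using bnd[of "(k, True)" for k] bnd[of "(k, False)" for k] by (intro AE_I2) (simp add: abs_le_iff, smt (verit))
  qed simp
  have pos: "0 \<le> (?g k True + ?g k False) / 2" for k
    using level_gap_sum(1)[of \<sigma> k "limit \<sigma>" x, OF \<sigma> near] by simp
  show "objective kinked (sample_law \<sigma>) (limit \<sigma>) \<le> objective kinked (sample_law \<sigma>) x"
    using gap pos by (smt (verit) integral_nonneg_AE AE_I2)
  assume x: "\<sigma> i * (x - center \<sigma> i) \<le> 0"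
  have "pmf W i * (\<beta> i * radius i / 4) = measure_pmf.expectation W (\<lambda>k. indicator {i} k * (\<beta> i * radius i / 4))"
    by (simp add: measure_pmf_single)
  also have "\<dots> \<le> measure_pmf.expectation W (\<lambda>k. (?g k True + ?g k False) / 2)"
  proof (rule integral_mono)
    show "integrable (measure_pmf W) (\<lambda>k. indicator {i} k * (\<beta> i * radius i / 4))"
      by (rule measure_pmf.integrable_const_bound[where B="\<bar>\<beta> i * radius i / 4\<bar>"]) (auto simp: indicator_def)
    show "indicator {i} k * (\<beta> i * radius i / 4) \<le> (?g k True + ?g k False) / 2" for k
      using level_gap_sum(2)[of \<sigma> i "limit \<sigma>" x, OF \<sigma> near x] pos[of k] by (auto simp: indicator_def mult.commute)
  qed (rule intW)
  finally show "pmf W i * (\<beta> i * radius i / 4) \<le>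
        objective kinked (sample_law \<sigma>) x - objective kinked (sample_law \<sigma>) (limit \<sigma>)"
    using gap by linarith
qed

lemma opt_value_sample_law:
  assumes "\<And>j. \<bar>\<sigma> j\<bar> = 1"
  shows "opt_value kinked (sample_law \<sigma>) = objective kinked (sample_law \<sigma>) (limit \<sigma>)"
  unfolding opt_value_def
  by (rule cInf_eq_minimum) (use objective_gap(1)[OF assms] in auto)

text \<open>At level 0 the interval is [-1, 1], and it contains the minimizer
  \<open>limit \<sigma>\<close>.\<close>

lemma edist_argmin_sample_law:
  assumes \<sigma>: "\<And>j. \<bar>\<sigma> j\<bar> = 1"
  shows "edist_set 0 (argmin (objective kinked (sample_law \<sigma>))) \<le> 1"
proof -
  have \<sigma>1: "\<And>j. \<bar>\<sigma> j\<bar> \<le> 1" using \<sigma> by (simp add: eq_refl)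
  have "limit \<sigma> \<in> argmin (objective kinked (sample_law \<sigma>))"
    using objective_gap(1)[OF \<sigma>] by (auto simp: argmin_def is_arg_min_def not_less)
  moreover have "\<bar>limit \<sigma>\<bar> \<le> 1"
    using abs_limit_center_le[of \<sigma> 0, OF \<sigma>1] by (simp add: center_def radius_def)
  ultimately show ?thesis
    unfolding edist_set_def by (intro INF_lower2) (auto simp: dist_real_def one_ereal_def)
qed

end

subsection \<open>The prior on signs\<close>

text \<open>Thresholding yields genuine signs for every real sequence, so the instance constraints
  hold on the whole space of the prior and not just almost surely.\<close>

definition sign_seq :: "(nat \<Rightarrow> real) \<Rightarrow> nat \<Rightarrow> real" where
  "sign_seq v k = pm (v k > 0)"

lemma abs_sign_seq: "\<bar>sign_seq v k\<bar> = 1"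
  by (simp add: sign_seq_def)

lemma abs_sign_seq_le: "\<bar>sign_seq v k\<bar> \<le> 1"
  by (simp add: abs_sign_seq)

definition fair_sign :: "real measure" where
  "fair_sign = distr (measure_pmf (bernoulli_pmf (1 / 2))) borel pm"

definition sign_prior :: "(nat \<Rightarrow> real) measure" where
  "sign_prior = PiM UNIV (\<lambda>_. fair_sign)"

text \<open>The new entry is built from the thresholded sign; plain negation would leave the sign at
  the value 0 unchanged.\<close>

definition flip :: "nat \<Rightarrow> (nat \<Rightarrow> real) \<Rightarrow> nat \<Rightarrow> real" where
  "flip i v = v(i := - pm (v i > 0))"

lemma sign_seq_flip: "sign_seq (flip i v) = (sign_seq v)(i := - sign_seq v i)"
  by (auto simp: sign_seq_def flip_def)

lemma sets_fair_sign [simp, measurable_cong]: "sets fair_sign = sets borel"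
  by (simp add: fair_sign_def)

lemma prob_space_fair_sign: "prob_space fair_sign"
  unfolding fair_sign_def by (rule measure_pmf.prob_space_distr) simp

lemma prob_space_sign_prior: "prob_space sign_prior"
  unfolding sign_prior_def by (intro prob_space_PiM prob_space_fair_sign)

lemma sets_sign_prior [measurable_cong]: "sets sign_prior = sets (PiM UNIV (\<lambda>_. borel))"
  unfolding sign_prior_def by (intro sets_PiM_cong) auto

lemma space_sign_prior: "space sign_prior = UNIV"
  using sets_eq_imp_space_eq[OF sets_sign_prior] by (simp add: space_PiM)

lemma distr_fair_sign_flip: "distr fair_sign borel (\<lambda>t. - pm (t > 0)) = fair_sign"
proof -
  have "fair_sign = distr (measure_pmf (map_pmf Not (bernoulli_pmf (1 / 2)))) borel pm"
    by (simp add: fair_sign_def map_pmf_Not_fair_coin)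
  also have "\<dots> = distr (measure_pmf (bernoulli_pmf (1 / 2))) borel (pm \<circ> Not)"
    unfolding map_pmf_rep_eq by (subst distr_distr) auto
  also have "\<dots> = distr fair_sign borel (\<lambda>t. - pm (t > 0))"
    unfolding fair_sign_def
    by (subst distr_distr) (auto intro!: distr_cong)
  finally show ?thesis by simp
qed

lemma flip_measurable [measurable]: "flip i \<in> sign_prior \<rightarrow>\<^sub>M sign_prior"
proof -
  have "flip i \<in> PiM UNIV (\<lambda>_. borel) \<rightarrow>\<^sub>M PiM UNIV (\<lambda>_. borel)"
    unfolding flip_def
  proof (rule measurable_PiM_single')
    show "(\<lambda>v. (v(i := - pm (0 < v i))) j) \<in> borel_measurable (PiM UNIV (\<lambda>_. borel))" for j
      by (cases "j = i") auto
  qed (auto simp: space_PiM)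
  then show ?thesis
    by (simp cong: measurable_cong_sets add: sets_sign_prior)
qed

text \<open>Only coordinate \<open>i\<close> is changed, and its law is symmetric; checking
  cylinders is enough. This invariance is what pairs each \<open>v\<close> with
  \<open>flip i v\<close> in the final average.\<close>

lemma distr_sign_prior_flip: "distr sign_prior sign_prior (flip i) = sign_prior"
proof -
  interpret fair_sign: prob_space fair_sign by (rule prob_space_fair_sign)
  interpret product_prob_space "\<lambda>_::nat. fair_sign" UNIV by unfold_locales
  show ?thesis
    unfolding sign_prior_def
  proof (rule PiM_eq)
    show "sets (distr (PiM UNIV (\<lambda>_. fair_sign)) (PiM UNIV (\<lambda>_. fair_sign)) (flip i)) = sets (PiM UNIV (\<lambda>_. fair_sign))"
      by simp
    fix J and F :: "nat \<Rightarrow> real set"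
    assume J: "finite J" and F: "\<And>j. j \<in> J \<Longrightarrow> F j \<in> sets fair_sign"
    let ?\<gamma> = "\<lambda>t::real. - pm (t > 0)"
    \<comment> \<open>Replacing side \<open>i\<close> by its preimage makes the preimage of the
      cylinder a cylinder again.\<close>
    define F' where "F' = F(i := ?\<gamma> -` F i)"
    have \<gamma>: "?\<gamma> -` F i \<in> sets borel" if "i \<in> J"
      using measurable_sets[of ?\<gamma> borel borel "F i"] F[OF that] by auto
    have F': "F' j \<in> sets fair_sign" if "j \<in> J" for j
      using F[OF that] \<gamma> that by (auto simp: F'_def)
    have same: "emeasure fair_sign (F' j) = emeasure fair_sign (F j)" if "j \<in> J" for j
    proof (cases "j = i")
      case True
      then have "emeasure fair_sign (F j) = emeasure (distr fair_sign borel ?\<gamma>) (F i)"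
        by (simp add: distr_fair_sign_flip)
      also have "\<dots> = emeasure fair_sign (F' j)"
        using F[OF that] True sets_eq_imp_space_eq[OF sets_fair_sign]
        by (subst emeasure_distr) (auto simp: F'_def)
      finally show ?thesis by simp
    qed (simp add: F'_def)
    have "emeasure (distr (PiM UNIV (\<lambda>_. fair_sign)) (PiM UNIV (\<lambda>_. fair_sign)) (flip i))
        (prod_emb UNIV (\<lambda>_. fair_sign) J (Pi\<^sub>E J F)) =
        emeasure (PiM UNIV (\<lambda>_. fair_sign)) (prod_emb UNIV (\<lambda>_. fair_sign) J (Pi\<^sub>E J F'))"
    proof (subst emeasure_distr)
      show "prod_emb UNIV (\<lambda>_. fair_sign) J (Pi\<^sub>E J F) \<in> sets (PiM UNIV (\<lambda>_. fair_sign))"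
        using J F by (intro sets_PiM_I) auto
      show "flip i \<in> PiM UNIV (\<lambda>_. fair_sign) \<rightarrow>\<^sub>M PiM UNIV (\<lambda>_. fair_sign)"
        using flip_measurable[of i] by (simp add: sign_prior_def)
      have "flip i -` prod_emb UNIV (\<lambda>_. fair_sign) J (Pi\<^sub>E J F) \<inter> space (PiM UNIV (\<lambda>_. fair_sign)) =
          prod_emb UNIV (\<lambda>_. fair_sign) J (Pi\<^sub>E J F')"
        using sets_eq_imp_space_eq[OF sets_fair_sign]
        by (auto simp: prod_emb_def space_PiM flip_def F'_def PiE_iff split: if_splits)
      then show "emeasure (PiM UNIV (\<lambda>_. fair_sign))
          (flip i -` prod_emb UNIV (\<lambda>_. fair_sign) J (Pi\<^sub>E J F) \<inter> space (PiM UNIV (\<lambda>_. fair_sign))) =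
        emeasure (PiM UNIV (\<lambda>_. fair_sign)) (prod_emb UNIV (\<lambda>_. fair_sign) J (Pi\<^sub>E J F'))" by simp
    qed
    also have "\<dots> = (\<Prod>j\<in>J. emeasure fair_sign (F' j))"
      using J F' by (intro emeasure_PiM_emb) auto
    also have "\<dots> = (\<Prod>j\<in>J. emeasure fair_sign (F j))"
      by (intro prod.cong refl same)
    finally show "emeasure (distr (PiM UNIV (\<lambda>_. fair_sign)) (PiM UNIV (\<lambda>_. fair_sign)) (flip i))
        (prod_emb UNIV (\<lambda>_. fair_sign) J (Pi\<^sub>E J F)) = (\<Prod>j\<in>J. emeasure fair_sign (F j))" .
  qed
qed

lemma sign_seq_measurable [measurable]: "(\<lambda>v. sign_seq v k) \<in> borel_measurable sign_prior"
  unfolding sign_seq_def by measurable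

lemma center_measurable [measurable]: "(\<lambda>v. center (sign_seq v) k) \<in> borel_measurable sign_prior"
  unfolding center_def by measurable

lemma limit_measurable [measurable]: "(\<lambda>v. limit (sign_seq v)) \<in> borel_measurable sign_prior"
  unfolding limit_def by measurable

section \<open>Measurability in the sign sequence\<close>

context hard_instance
begin

abbreviation instance_law :: "(nat \<Rightarrow> real) \<Rightarrow> (nat \<Rightarrow> real) measure" where
  "instance_law v \<equiv> sample_law (sign_seq v)"

lemma tilt_measurable [measurable]: "(\<lambda>v. tilt (sign_seq v) z) \<in> borel_measurable sign_prior"
  unfolding tilt_def by measurable

lemma sample_component_measurable [measurable]:
  "(\<lambda>v. sample (sign_seq v) z j) \<in> borel_measurable sign_prior"
  unfolding sample_def by (cases "j = 0"; cases "j = 1"; cases "j = 2") simp_all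

lemma sample_measurable_joint [measurable]:
  "(\<lambda>v. sample (sign_seq v) z) \<in> sign_prior \<rightarrow>\<^sub>M sample_space"
  by (rule measurable_PiM_single') (auto simp: space_PiM)

text \<open>The latent space is countable, so joint measurability reduces to fixed latent outcomes
  \<open>z\<close>, where density and sample are measurable in \<open>v\<close>.\<close>

lemma instance_law_measurable: "instance_law \<in> sign_prior \<rightarrow>\<^sub>M prob_algebra sample_space"
proof -
  have "(\<lambda>v. tilted (sign_seq v)) \<in> sign_prior \<rightarrow>\<^sub>M prob_algebra (count_space UNIV)"
  proof (rule measurable_prob_algebraI)
    show "prob_space (tilted (sign_seq v))" for v
      by (rule prob_space_tilted[OF abs_sign_seq_le])
    show "(\<lambda>v. tilted (sign_seq v)) \<in> sign_prior \<rightarrow>\<^sub>M subprob_algebra (count_space UNIV)"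
    proof (rule measurable_subprob_algebra)
      show "subprob_space (tilted (sign_seq v))" for v
        by (rule prob_space_imp_subprob_space[OF prob_space_tilted[OF abs_sign_seq_le]])
      show "sets (tilted (sign_seq v)) = sets (count_space UNIV)" for v
        by (simp add: sets_tilted)
      fix A :: "(nat \<times> bool) set"
      have [measurable]: "(\<lambda>(v, z). ennreal (tilt (sign_seq v) z) * indicator A z)
          \<in> borel_measurable (sign_prior \<Otimes>\<^sub>M measure_pmf latent)"
        by (rule measurable_pair_countable_snd) auto
      have "(\<lambda>v. \<integral>\<^sup>+z. ennreal (tilt (sign_seq v) z) * indicator A z \<partial>measure_pmf latent) \<in> borel_measurable sign_prior"
        by (rule measure_pmf.borel_measurable_nn_integral) measurable
      then show "(\<lambda>v. emeasure (tilted (sign_seq v)) A) \<in> borel_measurable sign_prior"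
        unfolding tilted_def by (subst emeasure_density) auto
    qed
  qed
  then show ?thesis
    unfolding sample_law_def
  proof (rule measurable_distr_prob_space2)
    show "(\<lambda>(v, z). sample (sign_seq v) z) \<in> sign_prior \<Otimes>\<^sub>M count_space UNIV \<rightarrow>\<^sub>M sample_space"
      by (rule measurable_pair_countable_snd) auto
  qed
qed

text \<open>The evaluation point varies with the outcome, to cover both the output of the method and
  the minimizer.\<close>

lemma objective_measurable [measurable]:
  assumes [measurable]: "w \<in> M \<rightarrow>\<^sub>M sign_prior" "\<xi> \<in> borel_measurable M"
  shows "(\<lambda>p. objective kinked (instance_law (w p)) (\<xi> p)) \<in> borel_measurable M"
proof -
  have [measurable]: "(\<lambda>p. tilt (sign_seq (w p)) z) \<in> borel_measurable M"
    "(\<lambda>p. sample (sign_seq (w p)) z j) \<in> borel_measurable M" for z j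
    by (rule measurable_compose[OF assms(1)], measurable)+
  have "(\<lambda>(p, z). tilt (sign_seq (w p)) z * kinked (\<xi> p) (sample (sign_seq (w p)) z))
      \<in> borel_measurable (M \<Otimes>\<^sub>M measure_pmf latent)"
    by (rule measurable_pair_countable_snd) (auto simp: kinked_def)
  then show ?thesis
    unfolding objective_sample_law[OF abs_sign_seq_le]
    by (rule measure_pmf.borel_measurable_lebesgue_integral)
qed

end

subsection \<open>The lower bound\<close>

context hard_instance
begin

text \<open>The tilting density is at most 2.\<close>

lemma prob_tilted_le:
  assumes "\<And>j. \<bar>\<sigma> j\<bar> \<le> 1"
  shows "measure (tilted \<sigma>) {z. fst z \<in> K} \<le> 2 * measure_pmf.prob W K"
proof -
  have "emeasure (tilted \<sigma>) {z. fst z \<in> K} =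
      (\<integral>\<^sup>+z. ennreal (tilt \<sigma> z) * indicator {z. fst z \<in> K} z \<partial>measure_pmf latent)"
    unfolding tilted_def by (subst emeasure_density) auto
  also have "\<dots> \<le> (\<integral>\<^sup>+z. 2 * indicator {z. fst z \<in> K} z \<partial>measure_pmf latent)"
    using tilt_bounds(2)[of \<sigma>, OF assms]
    by (intro nn_integral_mono mult_right_mono) (auto simp: ennreal_le_iff2 simp flip: ennreal_numeral)
  also have "\<dots> = 2 * emeasure (measure_pmf latent) {z. fst z \<in> K}"
    by (subst nn_integral_cmult_indicator) auto
  also have "emeasure (measure_pmf latent) {z. fst z \<in> K} = emeasure (map_pmf fst latent) K"
    by (simp add: vimage_def)
  also have "map_pmf fst latent = W"
    by (simp add: latent_def map_fst_pair_pmf)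
  finally have "emeasure (tilted \<sigma>) {z. fst z \<in> K} \<le> ennreal (2 * measure_pmf.prob W K)"
    by (simp add: measure_pmf.emeasure_eq_measure ennreal_mult)
  then show ?thesis
    by (simp add: measure_def enn2real_leI)
qed

text \<open>Each sign affects the density at its own level only, so the factor of level
  \<open>i\<close> splits off from a law that is unbiased there.\<close>

lemma tilted_eq_density:
  assumes "\<And>j. \<bar>\<sigma> j\<bar> \<le> 1"
  shows "tilted \<sigma> = density (tilted (\<sigma>(i := 0)))
    (\<lambda>z. ennreal (1 + (if fst z = i then \<beta> i * \<sigma> i * pm (snd z) else 0)))"
proof -
  have 1: "\<bar>(\<sigma>(i := 0)) j\<bar> \<le> 1" for j using assms by simp
  have "tilt \<sigma> z = tilt (\<sigma>(i := 0)) z * (1 + (if fst z = i then \<beta> i * \<sigma> i * pm (snd z) else 0))" for z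
    by (simp add: tilt_def)
  then have "ennreal (tilt \<sigma> z) = ennreal (tilt (\<sigma>(i := 0)) z) *
      ennreal (1 + (if fst z = i then \<beta> i * \<sigma> i * pm (snd z) else 0))" for z
    using tilt_bounds(1)[of "\<sigma>(i := 0)" z, OF 1] by (simp only: ennreal_mult')
  then show ?thesis
    unfolding tilted_def by (subst density_density_eq) auto
qed

text \<open>Both sample laws are pulled back to the latent space, each along its own
  \<open>sample\<close> map. There they are opposite tilts of one law at level \<open>i\<close>, and
  the two maps agree on draws with no level above \<open>i\<close>. Tilting may double the tail
  bound \<open>1/12\<close>, giving the \<open>1/6\<close> of the testing lemma.\<close>

lemma sample_law_two_point:
  assumes \<sigma>: "\<And>j. \<bar>\<sigma> j\<bar> \<le> 1" and fin: "finite I"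
    and small: "(1 + (\<beta> i)\<^sup>2) ^ card I \<le> 17 / 16"
    and tail: "card I * measure_pmf.prob W {i<..} \<le> 1 / 12"
    and X: "X \<in> sets (PiM I (\<lambda>_. sample_space))" "X' \<in> sets (PiM I (\<lambda>_. sample_space))"
    and cover: "X \<union> X' = space (PiM I (\<lambda>_. sample_space))"
  shows "measure (PiM I (\<lambda>_. sample_law \<sigma>)) X +
    measure (PiM I (\<lambda>_. sample_law (\<sigma>(i := - \<sigma> i)))) X' \<ge> 1 / 3"
proof -
  define \<sigma>' where "\<sigma>' = \<sigma>(i := - \<sigma> i)"
  define \<sigma>\<^sub>0 where "\<sigma>\<^sub>0 = \<sigma>(i := 0)"
  define g where "g z = (if fst z = i then \<beta> i * \<sigma> i * pm (snd z) else 0)" for z :: "nat \<times> bool"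
  have \<sigma>': "\<bar>\<sigma>' j\<bar> \<le> 1" and \<sigma>\<^sub>0: "\<bar>\<sigma>\<^sub>0 j\<bar> \<le> 1" for j
    using \<sigma> by (simp_all add: \<sigma>'_def \<sigma>\<^sub>0_def)
  have tilted: "tilted \<sigma> = density (tilted \<sigma>\<^sub>0) (\<lambda>z. ennreal (1 + g z))"
    using tilted_eq_density[of \<sigma> i, OF \<sigma>] by (simp add: g_def \<sigma>\<^sub>0_def)
  have tilted': "tilted \<sigma>' = density (tilted \<sigma>\<^sub>0) (\<lambda>z. ennreal (1 - g z))"
  proof -
    have "1 - g z = 1 + (if fst z = i then \<beta> i * \<sigma>' i * pm (snd z) else 0)" for z
      by (simp add: g_def \<sigma>'_def)
    moreover have "\<sigma>'(i := 0) = \<sigma>\<^sub>0"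
      by (simp add: \<sigma>'_def \<sigma>\<^sub>0_def)
    ultimately show ?thesis
      using tilted_eq_density[of \<sigma>' i, OF \<sigma>'] by (simp only:)
  qed
  interpret B: prob_space "tilted \<sigma>\<^sub>0" by (rule prob_space_tilted[OF \<sigma>\<^sub>0])
  have pull: "measure (PiM I (\<lambda>_. sample_law \<tau>)) Y =
      measure (PiM I (\<lambda>_. tilted \<tau>)) (compose I (sample \<tau>) -` Y \<inter> space (PiM I (\<lambda>_. tilted \<sigma>\<^sub>0)))"
    and pull_sets: "compose I (sample \<tau>) -` Y \<inter> space (PiM I (\<lambda>_. tilted \<sigma>\<^sub>0)) \<in> sets (PiM I (\<lambda>_. tilted \<sigma>\<^sub>0))"
    if \<tau>: "\<And>j. \<bar>\<tau> j\<bar> \<le> 1" and Y: "Y \<in> sets (PiM I (\<lambda>_. sample_space))" for \<tau> Y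
  proof -
    have S: "prob_space (sample_law \<tau>)" by (rule prob_space_sample_law[OF \<tau>])
    have s: "sets (PiM I (\<lambda>_. sample_law \<tau>)) = sets (PiM I (\<lambda>_. sample_space))"
      by (rule sets_PiM_cong) (simp_all add: sample_law_def)
    have "sample \<tau> \<in> tilted \<tau> \<rightarrow>\<^sub>M sample_law \<tau>"
      using sample_measurable[of \<tau>] by (simp add: sample_law_def)
    then have "distr (PiM I (\<lambda>_. tilted \<tau>)) (PiM I (\<lambda>_. sample_law \<tau>)) (compose I (sample \<tau>)) =
        PiM I (\<lambda>_. distr (tilted \<tau>) (sample_law \<tau>) (sample \<tau>))"
      by (intro distr_PiM_finite_prob_space' fin prob_space_tilted[OF \<tau>] S)
    also have "distr (tilted \<tau>) (sample_law \<tau>) (sample \<tau>) = sample_law \<tau>"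
      unfolding sample_law_def by (rule distr_cong) auto
    finally have D: "PiM I (\<lambda>_. sample_law \<tau>) =
        distr (PiM I (\<lambda>_. tilted \<tau>)) (PiM I (\<lambda>_. sample_law \<tau>)) (compose I (sample \<tau>))" ..
    have t: "sets (PiM I (\<lambda>_. tilted \<tau>)) = sets (PiM I (\<lambda>_. tilted \<sigma>\<^sub>0))"
      by (rule sets_PiM_cong) (simp_all add: sets_tilted)
    have C: "compose I (sample \<tau>) \<in> PiM I (\<lambda>_. tilted \<tau>) \<rightarrow>\<^sub>M PiM I (\<lambda>_. sample_law \<tau>)"
      unfolding compose_def
    proof (rule measurable_restrict)
      fix k assume "k \<in> I"
      then have "(\<lambda>l. l k) \<in> PiM I (\<lambda>_. tilted \<tau>) \<rightarrow>\<^sub>M tilted \<tau>"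
        by (rule measurable_component_singleton)
      then show "(\<lambda>l. sample \<tau> (l k)) \<in> PiM I (\<lambda>_. tilted \<tau>) \<rightarrow>\<^sub>M sample_law \<tau>"
        by (rule measurable_compose) fact
    qed
    show "measure (PiM I (\<lambda>_. sample_law \<tau>)) Y =
      measure (PiM I (\<lambda>_. tilted \<tau>)) (compose I (sample \<tau>) -` Y \<inter> space (PiM I (\<lambda>_. tilted \<sigma>\<^sub>0)))"
      using Y s by (subst D, subst measure_distr[OF C]) (simp_all add: sets_eq_imp_space_eq[OF t])
    show "compose I (sample \<tau>) -` Y \<inter> space (PiM I (\<lambda>_. tilted \<sigma>\<^sub>0)) \<in> sets (PiM I (\<lambda>_. tilted \<sigma>\<^sub>0))"
      using measurable_sets[OF C, of Y] Y s t by (simp add: sets_eq_imp_space_eq[OF t])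
  qed
  have "1 / 3 \<le> measure (PiM I (\<lambda>_. density (tilted \<sigma>\<^sub>0) (\<lambda>z. ennreal (1 + g z))))
        (compose I (sample \<sigma>) -` X \<inter> space (PiM I (\<lambda>_. tilted \<sigma>\<^sub>0))) +
      measure (PiM I (\<lambda>_. density (tilted \<sigma>\<^sub>0) (\<lambda>z. ennreal (1 - g z))))
        (compose I (sample \<sigma>') -` X' \<inter> space (PiM I (\<lambda>_. tilted \<sigma>\<^sub>0)))"
  proof (rule B.two_point_testing[OF fin _ _ \<beta>_le_1[of i] _ small])
    show "g \<in> borel_measurable (tilted \<sigma>\<^sub>0)"
      by (simp add: measurable_def sets_tilted)
    show "\<bar>g z\<bar> \<le> \<beta> i" for z
      using abs_tilt_le[of \<sigma> i "snd z", OF \<sigma>] \<beta>_nonneg[of i] by (simp add: g_def)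
    show "B.expectation g = 0"
    proof -
      have "B.expectation g = measure_pmf.expectation latent (\<lambda>z. tilt \<sigma>\<^sub>0 z * g z)"
        unfolding tilted_def using tilt_bounds[of \<sigma>\<^sub>0, OF \<sigma>\<^sub>0] by (subst integral_real_density) auto
      \<comment> \<open>Where \<open>g\<close> is supported, at level \<open>i\<close>, the tilt of
        \<open>\<sigma>\<^sub>0\<close> is 1; the product is therefore again a centred bias
        term.\<close>
      also have "(\<lambda>z. tilt \<sigma>\<^sub>0 z * g z) =
          (\<lambda>z. \<beta> (fst z) * (\<lambda>k. if k = i then \<sigma> i else 0) (fst z) * pm (snd z))"
        by (auto simp: tilt_def g_def \<sigma>\<^sub>0_def)
      also have "measure_pmf.expectation latent \<dots> = 0"
        by (rule tilt_mean)
      finally show ?thesis .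
    qed
    show "{z. fst z \<in> {..i}} \<in> B.events"
      by (simp add: sets_tilted)
    have "1 - B.prob {z. fst z \<in> {..i}} = B.prob {z. fst z \<in> {i<..}}"
      by (subst B.prob_compl[symmetric])
         (auto simp: sets_tilted space_tilted not_le intro!: arg_cong[where f=B.prob])
    also have "\<dots> \<le> 2 * measure_pmf.prob W {i<..}"
      by (rule prob_tilted_le[OF \<sigma>\<^sub>0])
    finally have "card I * (1 - B.prob {z. fst z \<in> {..i}}) \<le> card I * (2 * measure_pmf.prob W {i<..})"
      by (intro mult_left_mono) auto
    then show "card I * (1 - B.prob {z. fst z \<in> {..i}}) \<le> 1 / 6"
      using tail by linarith
    show "Pi\<^sub>E I (\<lambda>_. {z :: nat \<times> bool. fst z \<in> {..i}}) \<subseteq>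
        (compose I (sample \<sigma>) -` X \<inter> space (PiM I (\<lambda>_. tilted \<sigma>\<^sub>0))) \<union>
        (compose I (sample \<sigma>') -` X' \<inter> space (PiM I (\<lambda>_. tilted \<sigma>\<^sub>0)))"
    proof
      fix l assume l: "l \<in> Pi\<^sub>E I (\<lambda>_. {z :: nat \<times> bool. fst z \<in> {..i}})"
      have "sample \<sigma> (l k) = sample \<sigma>' (l k)" if "k \<in> I" for k
      proof -
        \<comment> \<open>A centre depends only on signs of strictly smaller levels, so level
          \<open>i\<close> itself is still shared.\<close>
        have "center \<sigma> (fst (l k)) = center \<sigma>' (fst (l k))"
          using l that by (intro center_cong) (auto simp: \<sigma>'_def PiE_iff)
        then show ?thesis by (auto simp: sample_def fun_eq_iff)
      qed
      then have "compose I (sample \<sigma>) l = compose I (sample \<sigma>') l"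
        by (auto simp: compose_def fun_eq_iff)
      moreover have "compose I (sample \<sigma>) l \<in> X \<union> X'"
        unfolding cover by (auto simp: space_PiM compose_def)
      moreover have "l \<in> space (PiM I (\<lambda>_. tilted \<sigma>\<^sub>0))"
        using l by (auto simp: space_PiM space_tilted PiE_iff)
      ultimately show "l \<in> (compose I (sample \<sigma>) -` X \<inter> space (PiM I (\<lambda>_. tilted \<sigma>\<^sub>0))) \<union>
        (compose I (sample \<sigma>') -` X' \<inter> space (PiM I (\<lambda>_. tilted \<sigma>\<^sub>0)))" by auto
    qed
  qed (use pull_sets[OF \<sigma> X(1)] pull_sets[OF \<sigma>' X(2)] in auto)
  then show ?thesis
    using pull[OF \<sigma> X(1)] pull[OF \<sigma>' X(2)] by (simp add: tilted tilted' flip: \<sigma>'_def)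
qed

text \<open>For \<open>v\<close> and \<open>flip i v\<close> the failure events cover all samples,
  so their conditional probabilities sum to at least 1/3 for each seed. As the prior is invariant
  under \<open>flip i\<close>, integration gives twice the failure probability, hence 1/6.\<close>

lemma error_probability_ge:
  assumes A: "(\<lambda>(u, s). a u s) \<in> (borel :: real measure) \<Otimes>\<^sub>M PiM {1..n} (\<lambda>_. sample_space) \<rightarrow>\<^sub>M borel"
    and small: "(1 + (\<beta> i)\<^sup>2) ^ n \<le> 17 / 16"
    and tail: "n * measure_pmf.prob W {i<..} \<le> 1 / 12"
    and \<epsilon>: "\<epsilon> \<le> pmf W i * (\<beta> i * radius i / 4)"
  shows "\<P>((v, u, s) in sampling_law sign_prior sample_space instance_law n.
      objective kinked (instance_law v) (a u s) - opt_value kinked (instance_law v) \<ge> \<epsilon>) \<ge> 1 / 6"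
proof -
  let ?U = "uniform_measure lborel {0..1::real}"
  let ?S = "PiM {1..n} (\<lambda>_. sample_space)"
  let ?M = "sign_prior \<Otimes>\<^sub>M (borel \<Otimes>\<^sub>M ?S)"
  let ?L = "sampling_law sign_prior sample_space instance_law n"
  let ?loss = "\<lambda>v x. objective kinked (instance_law v) x - opt_value kinked (instance_law v)"
  interpret U: prob_space ?U by (rule prob_space_uniform_measure) auto
  define X where "X = {p \<in> space ?M. ?loss (fst p) (a (fst (snd p)) (snd (snd p))) \<ge> \<epsilon>}"
  note A[measurable]
  have X: "X \<in> sets ?M"
    unfolding X_def opt_value_sample_law[OF abs_sign_seq] by measurable
  note law = emeasure_sampling_law[OF prob_space_sign_prior instance_law_measurable, of _ n]
  interpret L: prob_space ?L
    by (rule emeasure_sampling_law(2)[OF prob_space_sign_prior instance_law_measurable X])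
  define E where "E v u = {s. (v, u, s) \<in> X}" for v u
  define F where "F v = (\<integral>\<^sup>+u. emeasure (PiM {1..n} (\<lambda>_. instance_law v)) (E v u) \<partial>?U)" for v
  have sets_E: "E v u \<in> sets ?S" for v u
  proof -
    have "E v u = Pair u -` Pair v -` X" by (auto simp: E_def)
    then show ?thesis using sets_Pair1[OF sets_Pair1[OF X]] by simp
  qed
  have E_iff: "s \<in> E v u \<longleftrightarrow> s \<in> space ?S \<and> ?loss v (a u s) \<ge> \<epsilon>" for v u s
    by (auto simp: E_def X_def space_pair_measure space_sign_prior)
  have sets_P: "sets (PiM {1..n} (\<lambda>_. instance_law v)) = sets ?S" for v
    by (rule sets_PiM_cong) (simp_all add: sample_law_def)
  have prob_P: "prob_space (PiM {1..n} (\<lambda>_. instance_law v))" for v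
    by (intro prob_space_PiM prob_space_sample_law abs_sign_seq_le)
  have E_meas: "(\<lambda>u. emeasure (PiM {1..n} (\<lambda>_. instance_law v)) (E v u)) \<in> borel_measurable ?U" for v
  proof -
    interpret P: prob_space "PiM {1..n} (\<lambda>_. instance_law v)" by (rule prob_P)
    have "Pair v -` X \<in> sets (borel \<Otimes>\<^sub>M ?S)" by (rule sets_Pair1[OF X])
    also have "sets (borel \<Otimes>\<^sub>M ?S) = sets (?U \<Otimes>\<^sub>M PiM {1..n} (\<lambda>_. instance_law v))"
      using sets_P by (intro sets_pair_measure_cong) auto
    finally have "(\<lambda>u. emeasure (PiM {1..n} (\<lambda>_. instance_law v)) (Pair u -` Pair v -` X)) \<in> borel_measurable ?U"
      by (rule P.measurable_emeasure_Pair)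
    then show ?thesis by (simp add: E_def vimage_def)
  qed
  have pair: "ennreal (1 / 3) \<le> F v + F (flip i v)" for v
  proof -
    have "ennreal (1 / 3) \<le> emeasure (PiM {1..n} (\<lambda>_. instance_law v)) (E v u) +
        emeasure (PiM {1..n} (\<lambda>_. instance_law (flip i v))) (E (flip i v) u)" for u
    proof -
      interpret P: prob_space "PiM {1..n} (\<lambda>_. instance_law v)" by (rule prob_P)
      interpret P': prob_space "PiM {1..n} (\<lambda>_. instance_law (flip i v))" by (rule prob_P)
      let ?c = "center (sign_seq v) i"
      have c: "center (sign_seq (flip i v)) i = ?c"
        by (rule center_cong) (simp add: sign_seq_flip)
      have good: "?loss w x \<ge> \<epsilon>" if "sign_seq w i * (x - center (sign_seq w) i) \<le> 0" for w x
        using objective_gap(2)[of "sign_seq w", OF abs_sign_seq that] \<epsilon>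
        unfolding opt_value_sample_law[of "sign_seq w", OF abs_sign_seq] by linarith
      \<comment> \<open>The two sign sequences share the level-\<open>i\<close> centre, and every
        point is on its wrong side, or at it, for one of them.\<close>
      have "?loss v x \<ge> \<epsilon> \<or> ?loss (flip i v) x \<ge> \<epsilon>" for x
      proof (cases "sign_seq v i * (x - ?c) \<le> 0")
        case True
        then show ?thesis using good[of v x] by blast
      next
        case False
        then have "sign_seq (flip i v) i * (x - center (sign_seq (flip i v)) i) \<le> 0"
          unfolding c by (simp add: sign_seq_flip)
        then show ?thesis using good[of "flip i v" x] by blast
      qed
      then have "E v u \<union> E (flip i v) u = space ?S"
        unfolding set_eq_iff Un_iff E_iff by blast
      then have "1 / 3 \<le> P.prob (E v u) + P'.prob (E (flip i v) u)"
        using sample_law_two_point[of "sign_seq v" "{1..n}" i "E v u" "E (flip i v) u", OF abs_sign_seq_le]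
          small tail sets_E by (simp add: sign_seq_flip)
      then show ?thesis
        unfolding P.emeasure_eq_measure P'.emeasure_eq_measure
        by (subst ennreal_plus[symmetric]) (auto intro: ennreal_leI simp del: ennreal_plus)
    qed
    then have "(\<integral>\<^sup>+u. ennreal (1 / 3) \<partial>?U) \<le> (\<integral>\<^sup>+u. emeasure (PiM {1..n} (\<lambda>_. instance_law v)) (E v u) +
        emeasure (PiM {1..n} (\<lambda>_. instance_law (flip i v))) (E (flip i v) u) \<partial>?U)"
      by (intro nn_integral_mono)
    also have "\<dots> = F v + F (flip i v)"
      unfolding F_def by (rule nn_integral_add[OF E_meas E_meas])
    finally show ?thesis by (simp add: U.emeasure_space_1)
  qed
  \<comment> \<open>\<open>F v\<close> is the mass of the section of \<open>X\<close> at
    \<open>v\<close> under a measurable kernel.\<close>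
  have F_meas: "F \<in> borel_measurable sign_prior"
  proof -
    have K: "(\<lambda>v. ?U \<Otimes>\<^sub>M PiM {1..n} (\<lambda>_. instance_law v)) \<in> sign_prior \<rightarrow>\<^sub>M prob_algebra (borel \<Otimes>\<^sub>M ?S)"
      by (intro measurable_pair_prob measurable_PiM_kernel instance_law_measurable measurable_const)
         (auto simp: space_prob_algebra U.prob_space_axioms)
    have "(SIGMA v:space sign_prior. Pair v -` X) = X"
      using sets.sets_into_space[OF X] by (auto simp: space_pair_measure)
    then have "(\<lambda>v. emeasure (?U \<Otimes>\<^sub>M PiM {1..n} (\<lambda>_. instance_law v)) (Pair v -` X)) \<in> borel_measurable sign_prior"
      using X by (intro emeasure_measurable_subprob_algebra2[OF _ measurable_prob_algebraD[OF K]]) simp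
    also have "(\<lambda>v. emeasure (?U \<Otimes>\<^sub>M PiM {1..n} (\<lambda>_. instance_law v)) (Pair v -` X)) = F"
    proof
      fix v
      interpret P: prob_space "PiM {1..n} (\<lambda>_. instance_law v)" by (rule prob_P)
      have "Pair v -` X \<in> sets (borel \<Otimes>\<^sub>M ?S)" by (rule sets_Pair1[OF X])
      also have "sets (borel \<Otimes>\<^sub>M ?S) = sets (?U \<Otimes>\<^sub>M PiM {1..n} (\<lambda>_. instance_law v))"
        using sets_P by (intro sets_pair_measure_cong) auto
      finally have "Pair v -` X \<in> sets (?U \<Otimes>\<^sub>M PiM {1..n} (\<lambda>_. instance_law v))" .
      from P.emeasure_pair_measure_alt[OF this]
      show "emeasure (?U \<Otimes>\<^sub>M PiM {1..n} (\<lambda>_. instance_law v)) (Pair v -` X) = F v"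
        unfolding F_def E_def vimage_def by simp
    qed
    finally show ?thesis .
  qed
  have "ennreal (1 / 3) = (\<integral>\<^sup>+v. ennreal (1 / 3) \<partial>sign_prior)"
    using prob_space.emeasure_space_1[OF prob_space_sign_prior] by simp
  also have "\<dots> \<le> (\<integral>\<^sup>+v. F v + F (flip i v) \<partial>sign_prior)"
    by (intro nn_integral_mono pair)
  also have "\<dots> = (\<integral>\<^sup>+v. F v \<partial>sign_prior) + (\<integral>\<^sup>+v. F (flip i v) \<partial>sign_prior)"
    by (rule nn_integral_add[OF F_meas measurable_compose[OF flip_measurable F_meas]])
  also have "(\<integral>\<^sup>+v. F (flip i v) \<partial>sign_prior) = (\<integral>\<^sup>+v. F v \<partial>distr sign_prior sign_prior (flip i))"
    using F_meas by (subst nn_integral_distr) auto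
  also have "\<dots> = (\<integral>\<^sup>+v. F v \<partial>sign_prior)"
    by (simp add: distr_sign_prior_flip)
  also have "(\<integral>\<^sup>+v. F v \<partial>sign_prior) = emeasure ?L X"
    unfolding F_def E_def by (rule law(1)[OF X, symmetric])
  finally have "1 / 3 \<le> 2 * L.prob X"
    by (simp add: L.emeasure_eq_measure flip: ennreal_plus)
  then have "1 / 6 \<le> L.prob X" by simp
  moreover have "space ?L = space ?M"
    by (rule sets_eq_imp_space_eq[OF law(3)[OF X]])
  then have "X = {(v, u, s). (v, u, s) \<in> space ?L \<and> ?loss v (a u s) \<ge> \<epsilon>}"
    by (auto simp: X_def)
  ultimately show ?thesis by (simp only:)
qed

end

section \<open>Choice of the parameters\<close>

lemma exists_pmf_with_tails:
  fixes T :: "nat \<Rightarrow> real"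
  assumes T0: "T 0 = 1" and dec: "decseq T" and lim: "T \<longlonglongrightarrow> 0"
  obtains W :: "nat pmf" where "\<And>k. pmf W k = T k - T (Suc k)"
    and "\<And>k. measure_pmf.prob W {k<..} = T (Suc k)"
proof -
  have nn: "0 \<le> T k - T (Suc k)" for k using decseq_SucD[OF dec, of k] by simp
  have sums: "(\<lambda>k. T k - T (Suc k)) sums 1"
    using telescope_sums'[OF lim] T0 by simp
  define W where "W = embed_pmf (\<lambda>k. T k - T (Suc k))"
  have pmf_W: "pmf W k = T k - T (Suc k)" for k
    unfolding W_def
  proof (rule pmf_embed_pmf[OF nn])
    show "(\<integral>\<^sup>+ k. ennreal (T k - T (Suc k)) \<partial>count_space UNIV) = 1"
      using sums_unique[OF sums] sums_summable[OF sums] nn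
      by (subst nn_integral_count_space_nat) (simp add: suminf_ennreal_eq[OF nn sums])
  qed
  have "measure_pmf.prob W {..k} = 1 - T (Suc k)" for k
  proof -
    have "measure_pmf.prob W {..k} = (\<Sum>j\<le>k. T j - T (Suc j))"
      by (simp add: measure_measure_pmf_finite pmf_W)
    then show ?thesis using T0 by (simp add: sum_telescope)
  qed
  moreover have "measure_pmf.prob W {k<..} = 1 - measure_pmf.prob W {..k}" for k
    using measure_pmf.prob_compl[of "{..k}" W] by (simp add: Compl_eq_Diff_UNIV[symmetric])
  ultimately have "measure_pmf.prob W {k<..} = T (Suc k)" for k by simp
  with pmf_W show ?thesis by (rule that)
qed

lemma antimono_surj_small_values:
  fixes \<rho> :: "real \<Rightarrow> real"
  assumes bij: "bij_betw \<rho> {1..} {0<..1}" and anti: "antimono_on {1..} \<rho>" and "0 < \<epsilon>"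
  shows "\<exists>n::nat. (k::nat) < n \<and> \<rho> (real n) \<le> \<epsilon>"
proof -
  \<comment> \<open>The minimum keeps the target inside the range of \<open>\<rho>\<close>;
    monotonicity then keeps later values below it.\<close>
  have "min \<epsilon> 1 \<in> \<rho> ` {1..}"
    using bij \<open>0 < \<epsilon>\<close> by (auto simp: bij_betw_def)
  then obtain x where x: "1 \<le> x" "\<rho> x = min \<epsilon> 1" by auto
  obtain m :: nat where "x \<le> m" using real_arch_simple by blast
  then have "\<rho> (real (max m (Suc k))) \<le> \<rho> x"
    using x by (intro monotone_onD[OF anti]) auto
  then show ?thesis using x by (intro exI[of _ "max m (Suc k)"]) auto
qed

theorem theorem4:
  fixes \<rho> :: "real \<Rightarrow> real"
  assumes "bij_betw \<rho> {1..} {0<..1}"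
    and "antimono_on {1..} \<rho>"
  shows "\<exists>(S :: (nat \<Rightarrow> real) measure) (f :: real \<Rightarrow> (nat \<Rightarrow> real) \<Rightarrow> real)
          (Q :: (nat \<Rightarrow> real) measure) (P :: (nat \<Rightarrow> real) \<Rightarrow> (nat \<Rightarrow> real) measure)
          (n :: nat \<Rightarrow> nat).
      prob_space Q \<and> P \<in> Q \<rightarrow>\<^sub>M prob_algebra S \<and>
      (\<forall>s\<in>space S. convex_on UNIV (\<lambda>x. f x s) \<and> 1-lipschitz_on UNIV (\<lambda>x. f x s)) \<and>
      (\<forall>v\<in>space Q. (\<forall>x. integrable (P v) (f x)) \<and>
                   edist_set 0 (argmin (objective f (P v))) \<le> 1) \<and>
      (\<forall>i. 0 < n i) \<and> filterlim n at_top sequentially \<and>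
      (\<forall>A. stochastic_method S f A \<longrightarrow>
        (\<forall>i. \<P>((v, u, s) in sampling_law Q S P (n i).
               objective f (P v) (A (n i) f u s) - opt_value f (P v)
                 \<ge> \<rho> (real (n i)) / sqrt (real (n i))) \<ge> 1 / 6))"
proof -
  \<comment> \<open>\<open>T i\<close> is the probability of a level \<open>\<ge> i\<close>; \<open>n i\<close> must be chosen before \<open>T (Suc i)\<close>\<close>
  define N where "N i t = (SOME n::nat. i < n \<and> \<rho> n \<le> t * radius i / 40)" for i t
  have N: "i < N i t" "\<rho> (N i t) \<le> t * radius i / 40" if "0 < t" for i t
    using someI_ex[OF antimono_surj_small_values[OF assms, of "t * radius i / 40" i]] that radius_pos[of i]
    by (auto simp: N_def)
  \<comment> \<open>The factor 12 gives \<open>n i * T (Suc i) = T i / 12 \<le> 1 / 12\<close>, the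
    bound on seeing a level above \<open>i\<close>.\<close>
  define T where "T = rec_nat 1 (\<lambda>i t. t / (12 * real (N i t)))"
  define n where "n i = N i (T i)" for i
  have T0: "T 0 = 1" and TSuc: "T (Suc i) = T i / (12 * real (n i))" for i
    by (simp_all add: T_def n_def)
  have T_pos: "0 < T i" for i
  proof (induction i)
    case (Suc i)
    then have "0 < n i" using N(1)[of "T i" i] by (simp add: n_def)
    then show ?case using Suc by (simp add: TSuc)
  qed (simp add: T0)
  have n: "i < n i" "\<rho> (n i) \<le> T i * radius i / 40" for i
    using N[OF T_pos[of i]] by (simp_all add: n_def)
  have n_pos: "0 < n i" for i using n(1)[of i] by simp
  have T_half: "T (Suc i) \<le> T i / 2" for i
    using n_pos[of i] T_pos[of i] unfolding TSuc by (intro divide_left_mono) auto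
  have T_bound: "T i \<le> (1 / 2) ^ i" for i
  proof (induction i)
    case (Suc i)
    then show ?case using T_half[of i] by simp
  qed (simp add: T0)
  have "T \<longlonglongrightarrow> 0"
  proof (rule tendsto_sandwich[where f="\<lambda>_. 0" and h="\<lambda>i. (1 / 2) ^ i"])
    show "(\<lambda>i. (1 / 2 :: real) ^ i) \<longlonglongrightarrow> 0" by (rule LIMSEQ_power_zero) simp
    show "\<forall>\<^sub>F i in sequentially. 0 \<le> T i" using T_pos by (simp add: less_imp_le)
    show "\<forall>\<^sub>F i in sequentially. T i \<le> (1 / 2) ^ i" using T_bound by simp
  qed simp
  moreover have "decseq T"
    using T_half T_pos by (intro decseq_SucI) (smt (verit) field_sum_of_halves)
  ultimately obtain W where W: "\<And>k. pmf W k = T k - T (Suc k)"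
    and tail: "\<And>k. measure_pmf.prob W {k<..} = T (Suc k)"
    using exists_pmf_with_tails[of T, OF T0] by blast
  \<comment> \<open>The factor 5 keeps the second moment over \<open>n i\<close> samples below
    \<open>exp (1/25) \<le> 25/24 \<le> 17/16\<close>.\<close>
  define \<beta> where "\<beta> i = 1 / (5 * sqrt (n i))" for i
  have \<beta>2: "(\<beta> i)\<^sup>2 = 1 / (25 * n i)" for i by (simp add: \<beta>_def power_divide power_mult_distrib)
  interpret hard_instance W \<beta>
  proof
    fix k
    show "0 \<le> \<beta> k" by (simp add: \<beta>_def)
    have "1 \<le> sqrt (n k)" using n_pos[of k] by simp
    then have "1 \<le> 5 * sqrt (n k)" by linarith
    then show "\<beta> k \<le> 1" unfolding \<beta>_def by (intro divide_le_eq_1[THEN iffD2]) auto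
  qed
  have small: "(1 + (\<beta> i)\<^sup>2) ^ n i \<le> 17 / 16" for i
  proof -
    have "(1 + (\<beta> i)\<^sup>2) ^ n i \<le> exp ((\<beta> i)\<^sup>2) ^ n i"
      by (intro power_mono exp_ge_add_one_self) auto
    also have "\<dots> = exp (1 / 25 :: real)"
      using n_pos[of i] by (simp add: exp_of_nat_mult[symmetric] \<beta>2)
    also have "\<dots> \<le> 17 / 16"
    proof -
      have "24 / 25 * exp (1 / 25) \<le> exp (- (1 / 25)) * exp (1 / 25 :: real)"
        using exp_ge_add_one_self[of "- (1 / 25) :: real"] by (intro mult_right_mono) auto
      then show ?thesis by (simp add: exp_minus)
    qed
    finally show ?thesis .
  qed
  have mass: "n i * measure_pmf.prob W {i<..} \<le> 1 / 12" for i
  proof -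
    have "(1 / 2 :: real) ^ i \<le> 1" by (simp add: power_le_one)
    then show ?thesis
      using T_bound[of i] n_pos[of i] by (simp add: tail TSuc)
  qed
  have gap: "\<rho> (n i) / sqrt (n i) \<le> pmf W i * (\<beta> i * radius i / 4)" for i
  proof -
    \<comment> \<open>The 40 in the choice of \<open>n i\<close> is \<open>2 * 5 * 4\<close>: the
      weight of level \<open>i\<close> is at least \<open>T i / 2\<close>, its bias is
      \<open>1 / (5 * sqrt (n i))\<close>, and the excess carries a factor
      \<open>1/4\<close>.\<close>
    have "\<rho> (n i) / sqrt (n i) \<le> (T i / 2 * radius i / 20) / sqrt (n i)"
      using n(2)[of i] by (intro divide_right_mono) auto
    also have "\<dots> = T i / 2 * (\<beta> i * radius i / 4)"
      by (simp add: \<beta>_def)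
    also have "\<dots> \<le> pmf W i * (\<beta> i * radius i / 4)"
      using T_half[of i] \<beta>_nonneg[of i] radius_pos[of i] unfolding W by (intro mult_right_mono) auto
    finally show ?thesis .
  qed
  have n_lim: "filterlim n at_top sequentially"
    using n(1) by (intro filterlim_at_top_mono[OF filterlim_ident]) (auto intro!: always_eventually less_imp_le)
  have err: "1 / 6 \<le> \<P>((v, u, s) in sampling_law sign_prior sample_space instance_law (n i).
      objective kinked (instance_law v) (A (n i) kinked u s) - opt_value kinked (instance_law v)
        \<ge> \<rho> (real (n i)) / sqrt (real (n i)))"
    if "stochastic_method sample_space kinked A" for A i
    using that by (intro error_probability_ge[of _ _ i] small mass gap) (simp add: stochastic_method_def)
  show ?thesis
  proof (rule exI[of _ sample_space], rule exI[of _ kinked], rule exI[of _ sign_prior],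
      rule exI[of _ instance_law], rule exI[of _ n], intro conjI ballI allI impI)
    show "integrable (instance_law v) (kinked x)" for v x
      by (rule integrable_sample_law) (rule abs_sign_seq_le)
    show "edist_set 0 (argmin (objective kinked (instance_law v))) \<le> 1" for v
      by (rule edist_argmin_sample_law) (rule abs_sign_seq)
  qed (rule prob_space_sign_prior instance_law_measurable kinked_convex kinked_lipschitz n_pos n_lim | erule err)+
qed

end
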